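(* Let $m\ge 1$ and $h>1$ be integers such that $h\notin\{14+22k,\ 35+46k \mid k\in\mathbb{N}\}$. Then there exist infinitely many pairwise non-isomorphic one-dimensional Gorenstein local rings $R$ such that $H_R(h-1)-H_R(h)>m$.
   Context: $\mathbb{N}$ denotes the natural numbers including $0$. For a (Noetherian) local ring $(R,\mathfrak m)$ with residue field $R/\mathfrak m$, the Hilbert function of $R$ is $H_R(h)=\dim_{R/\mathfrak m}(\mathfrak m^h/\mathfrak m^{h+1})$ for $h\ge 0$. *)

theory Defs
  imports
    "HOL-Algebra.Algebra"
    "HOL-Library.Extended_Nat"
    "HOL-Computational_Algebra.Formal_Power_Series"
    "Jordan_Normal_Form.Missing_VectorSpace"
begin

text \<open>
  The rings whose existence is asserted have carriers in the type of complex formal power series,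
  with arbitrary operations. The type only serves as a set of continuum size in which to look for
  rings; it contains a copy of every ring with at most that many elements, for instance of every
  complete semigroup ring over a field of at most that size.
\<close>

definition noetherian_local_ring :: "('a, 'b) ring_scheme \<Rightarrow> bool" where
  "noetherian_local_ring R \<longleftrightarrow>
     cring R \<and> noetherian_ring R \<and> (\<exists>!M. maximalideal M R)"

definition max_ideal :: "('a, 'b) ring_scheme \<Rightarrow> 'a set" where
  "max_ideal R = (THE M. maximalideal M R)"

definition krull_dim :: "('a, 'b) ring_scheme \<Rightarrow> enat" where
  "krull_dim R = Sup {enat n | n.
     \<exists>P. (\<forall>i\<le>n. primeideal (P i) R) \<and> (\<forall>i<n. P i \<subset> P (Suc i))}"

primrec ideal_power :: "('a, 'b) ring_scheme \<Rightarrow> 'a set \<Rightarrow> nat \<Rightarrow> 'a set" where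
  "ideal_power R I 0 = carrier R"
| "ideal_power R I (Suc n) = ideal_prod R I (ideal_power R I n)"


section \<open>Hilbert function\<close>

text \<open>
  The quotient of the \<open>h\<close>-th by the \<open>(h + 1)\<close>-st power of the maximal ideal, as a set of
  cosets in \<open>R\<close>, with scalars in the residue field. The scalar multiplication
  \<open>(M +> a, N +> x) \<mapsto> N +> (a \<otimes> x)\<close>, with \<open>N\<close> the \<open>(h + 1)\<close>-st power, is
  \<^const>\<open>rcoset_mult\<close> modulo \<open>N\<close>; see \<open>graded_piece_smult\<close> below. The fields
  \<open>mult\<close> and \<open>one\<close> of a module record carry no meaning.
\<close>
definition graded_piece :: "('a, 'b) ring_scheme \<Rightarrow> nat \<Rightarrow> ('a set, 'a set) module" where
  "graded_piece R h = (let N = ideal_power R (max_ideal R) (Suc h) in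
     \<lparr>carrier = (\<lambda>x. N +>\<^bsub>R\<^esub> x) ` ideal_power R (max_ideal R) h,
      monoid.mult = undefined, monoid.one = undefined,
      ring.zero = N, ring.add = set_add R,
      smult = rcoset_mult R N\<rparr>)"

definition hilbert_function :: "('a, 'b) ring_scheme \<Rightarrow> nat \<Rightarrow> nat" where
  "hilbert_function R h = vectorspace.dim (R Quot max_ideal R) (graded_piece R h)"


section \<open>Gorenstein local rings\<close>

definition regular_module :: "('a, 'b) ring_scheme \<Rightarrow> ('a, 'a) module" where
  "regular_module R =
     \<lparr>carrier = carrier R, monoid.mult = monoid.mult R, monoid.one = monoid.one R,
      ring.zero = ring.zero R, ring.add = ring.add R,
      smult = monoid.mult R\<rparr>"

text \<open>
  The test modules \<open>A\<close>, \<open>B\<close> range over the modules whose carrier lies in the type of the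
  elements of \<open>R\<close>. This type contains \<open>R\<close> and its ideals, so by Baer's criterion the
  restriction does not affect the notion.
\<close>
definition injective_module :: "('a, 'c) ring_scheme \<Rightarrow> ('a, 'b, 'd) module_scheme \<Rightarrow> bool" where
  "injective_module R E \<longleftrightarrow> module R E \<and>
     (\<forall>(A :: ('a, 'a) module) (B :: ('a, 'a) module) i f.
        mod_hom R A B i \<and> inj_on i (carrier A) \<and> mod_hom R A E f \<longrightarrow>
        (\<exists>g. mod_hom R B E g \<and> (\<forall>x\<in>carrier A. g (i x) = f x)))"

definition injective_resolution ::
  "('a, 'c) ring_scheme \<Rightarrow> ('a, 'b) module \<Rightarrow> (nat \<Rightarrow> ('a, 'e) module) \<Rightarrow>
     ('b \<Rightarrow> 'e) \<Rightarrow> (nat \<Rightarrow> 'e \<Rightarrow> 'e) \<Rightarrow> bool" where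
  "injective_resolution R M E \<epsilon> d \<longleftrightarrow>
     (\<forall>i. injective_module R (E i)) \<and>
     mod_hom R M (E 0) \<epsilon> \<and> (\<forall>i. mod_hom R (E i) (E (Suc i)) (d i)) \<and>
     inj_on \<epsilon> (carrier M) \<and>
     \<epsilon> ` carrier M = a_kernel (E 0) (E 1) (d 0) \<and>
     (\<forall>i. d i ` carrier (E i) = a_kernel (E (Suc i)) (E (Suc (Suc i))) (d (Suc i)))"

text \<open>
  A Noetherian local ring is Gorenstein if it has finite injective dimension as a module over
  itself. The terms of the resolution have carriers in the type of the elements of \<open>R\<close>. This
  is no restriction: if \<open>R\<close> is infinite, the terms of the minimal injective resolution have at
  most as many elements as \<open>R\<close>; if \<open>R\<close> is finite and of finite injective dimension, it is
  self-injective.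
\<close>
definition gorenstein_local_ring :: "('a, 'b) ring_scheme \<Rightarrow> bool" where
  "gorenstein_local_ring R \<longleftrightarrow> noetherian_local_ring R \<and>
     (\<exists>n (E :: nat \<Rightarrow> ('a, 'a) module) \<epsilon> d.
        injective_resolution R (regular_module R) E \<epsilon> d \<and>
        (\<forall>i>n. carrier (E i) = {\<zero>\<^bsub>E i\<^esub>}))"


section \<open>Well-definedness\<close>

lemma max_ideal:
  assumes "noetherian_local_ring R"
  shows "maximalideal (max_ideal R) R"
  using assms theI'[of "\<lambda>M. maximalideal M R"]
  by (auto simp: noetherian_local_ring_def max_ideal_def)

lemma module_regular_module:
  assumes "cring R"
  shows "module R (regular_module R)"
proof -
  interpret cring R by fact
  show ?thesis
    by (intro moduleI abelian_groupI assms)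
       (auto simp: regular_module_def a_ac m_ac l_distr r_distr intro: add.l_inv_ex)
qed

lemma (in ring) ideal_power_ideal:
  assumes "ideal I R"
  shows "ideal (ideal_power R I n) R"
  by (induction n) (auto intro: oneideal ideal_prod_is_ideal assms)

context
  fixes R :: "('a, 'b) ring_scheme" (structure)
  assumes R: "noetherian_local_ring R"
begin

interpretation cring R
  using R by (simp add: noetherian_local_ring_def)

interpretation m: maximalideal "max_ideal R" R
  by (rule max_ideal[OF R])

interpretation p: ideal "ideal_power R (max_ideal R) n" R for n
  by (rule ideal_power_ideal[OF m.is_ideal])

lemma graded_piece_smult:
  assumes a: "a \<in> carrier R" and x: "x \<in> ideal_power R (max_ideal R) h"
  defines "N \<equiv> ideal_power R (max_ideal R) (Suc h)"
  shows "(max_ideal R +> a) \<odot>\<^bsub>graded_piece R h\<^esub> (N +> x) = N +> (a \<otimes> x)"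
proof -
  interpret N: ideal N R
    unfolding N_def by (rule p.is_ideal)
  have xR: "x \<in> carrier R"
    using x by (rule p.Icarr)
  have *: "N +> ((u \<oplus> a) \<otimes> (v \<oplus> x)) = N +> (a \<otimes> x)" if u: "u \<in> max_ideal R" and v: "v \<in> N" for u v
  proof -
    have uv: "u \<in> carrier R" "v \<in> carrier R"
      using m.Icarr[OF u] N.Icarr[OF v] by auto
    have "u \<otimes> x \<in> N"
      unfolding N_def using u x by (auto intro: ideal_prod.prod)
    then have n: "(u \<oplus> a) \<otimes> v \<oplus> u \<otimes> x \<in> N"
      using uv a v by (auto intro: N.I_l_closed N.a_closed)
    have "(u \<oplus> a) \<otimes> (v \<oplus> x) = ((u \<oplus> a) \<otimes> v \<oplus> u \<otimes> x) \<oplus> a \<otimes> x"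
      using uv a xR by algebra
    then have "(u \<oplus> a) \<otimes> (v \<oplus> x) \<in> N +> (a \<otimes> x)"
      using n by (auto simp: a_r_coset_def')
    then show ?thesis
      using a xR by (intro N.a_repr_independence'[symmetric]) auto
  qed
  have "max_ideal R \<noteq> {}" "N \<noteq> {}"
    using m.is_ideal N.is_ideal by (auto dest!: ideal.axioms(1) additive_subgroup.zero_closed)
  then show ?thesis
    unfolding graded_piece_def Let_def N_def[symmetric]
    by (auto simp: rcoset_mult_def a_r_coset_def'[of _ "max_ideal R"] a_r_coset_def'[of _ N x] *)
qed

lemma vectorspace_graded_piece:
  "vectorspace (R Quot max_ideal R) (graded_piece R h)"
proof -
  define N where "N = ideal_power R (max_ideal R) (Suc h)"
  define L where "L = ideal_power R (max_ideal R) h"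
  define G where "G = graded_piece R h"
  interpret N: ideal N R
    unfolding N_def by (rule p.is_ideal)
  interpret L: ideal L R
    unfolding L_def by (rule p.is_ideal)
  interpret F: field "R Quot max_ideal R"
    by (rule m.quotient_is_field) (rule is_cring)
  have carr: "carrier G = (\<lambda>x. N +> x) ` L"
    by (simp add: G_def graded_piece_def Let_def N_def L_def)
  have zero: "\<zero>\<^bsub>G\<^esub> = N +> \<zero>"
    unfolding a_coset_add_zero[OF N.a_subset] by (simp add: G_def graded_piece_def Let_def N_def)
  have FC: "carrier (R Quot max_ideal R) = (\<lambda>a. max_ideal R +> a) ` carrier R"
    by (auto simp: FactRing_simps)
  have add: "(N +> x) \<oplus>\<^bsub>G\<^esub> (N +> y) = N +> (x \<oplus> y)" if "x \<in> L" "y \<in> L" for x y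
    using that by (simp add: G_def graded_piece_def Let_def N.a_rcos_sum L.Icarr)
  have smult: "(max_ideal R +> a) \<odot>\<^bsub>G\<^esub> (N +> x) = N +> (a \<otimes> x)"
    if "a \<in> carrier R" "x \<in> L" for a x
    using graded_piece_smult[of a x h] that by (simp add: G_def N_def L_def)
  have Fops: "(max_ideal R +> a) \<oplus>\<^bsub>R Quot max_ideal R\<^esub> (max_ideal R +> b) = max_ideal R +> (a \<oplus> b)"
    "(max_ideal R +> a) \<otimes>\<^bsub>R Quot max_ideal R\<^esub> (max_ideal R +> b) = max_ideal R +> (a \<otimes> b)"
    if "a \<in> carrier R" "b \<in> carrier R" for a b
    using that by (simp_all add: FactRing_def m.a_rcos_sum m.rcoset_mult_add)
  have Fone: "\<one>\<^bsub>R Quot max_ideal R\<^esub> = max_ideal R +> \<one>"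
    by (simp add: FactRing_def)
  note [simp] = L.Icarr L.I_l_closed L.a_closed L.a_inv_closed
    additive_subgroup.zero_closed[OF ideal.axioms(1)[OF L.is_ideal]]
  have "module (R Quot max_ideal R) G"
  proof (intro moduleI abelian_groupI F.is_cring)
    fix Y assume "Y \<in> carrier G"
    then obtain x where x: "x \<in> L" "Y = N +> x" by (auto simp: carr)
    then have "(N +> (\<ominus> x)) \<oplus>\<^bsub>G\<^esub> Y = \<zero>\<^bsub>G\<^esub>"
      by (simp add: add zero l_neg)
    with x show "\<exists>y\<in>carrier G. y \<oplus>\<^bsub>G\<^esub> Y = \<zero>\<^bsub>G\<^esub>"
      by (auto simp: carr intro!: bexI[of _ "\<ominus> x"])
  qed (auto simp: carr zero FC add smult Fops Fone a_ac m_ac l_distr r_distr)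
  then show ?thesis
    unfolding G_def by (rule vectorspace.intro) (rule F.field_axioms)
qed

end

end

theory Submission
  imports Defs "HOL-Computational_Algebra.Formal_Laurent_Series" "HOL-Library.Nat_Bijection"
begin

text \<open>
  Let \<open>V\<close> be the ring of power series in \<open>x\<close>, with fraction field \<open>K\<close>, and let \<open>B\<close> be spanned over
  \<open>V\<close> by the squarefree monomials of degree less than \<open>N\<close> in \<open>r\<close> variables and by the elements
  \<open>f = y / x ^ (h - 1)\<close> for the monomials \<open>y\<close> of degree \<open>N > h\<close>, products of higher degree being zero.
  The element \<open>x ^ (h - 2) f\<close> lies in the power \<open>h - 1\<close> of the maximal ideal but not in the next one,
  whereas \<open>x ^ (h - 1) f = y\<close> already lies in the power \<open>N\<close>. So each monomial of degree \<open>N\<close>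
  contributes to the Hilbert function at \<open>h - 1\<close> but not at \<open>h\<close>, and for large \<open>r\<close> these monomials
  outnumber those of lower degree. The idealization \<open>R\<close> of \<open>Hom(B, V)\<close> over \<open>B\<close> inherits this, and it
  is Gorenstein: \<open>R\<close> is isomorphic to \<open>Hom(R, V)\<close>, so that \<open>Hom(R, _)\<close> turns the sequence
  \<open>V\<close>, \<open>K\<close>, \<open>K / V\<close>, whose last two terms are divisible, into an injective resolution of \<open>R\<close> of
  length one. Rings with different \<open>N\<close> are told apart by the orders of their nilpotent elements.
\<close>

text \<open>The idealization is encoded as one algebra of squarefree monomials on
  \<open>{0..r}\<close>. The index \<open>0\<close> marks the summand \<open>Hom(B, V)\<close>, so
  disjointness and admissibility of index sets give at once the product of \<open>B\<close>, its
  action on the dual, and square zero on the dual. Complementation exchanges a basis element with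
  its dual, which is the source of the self-duality. The maximal ideal and the powers of it that
  matter are lattices, cut out by one lower bound for the order at each index set, so their graded
  pieces can be counted set by set. The dual summand could spoil the drop, but between
  \<open>h - 1\<close> and \<open>h\<close> it gains only the duals of the monomials of degree
  \<open>N - h\<close>. The bound \<open>4 * N \<le> r\<close> makes the monomials of degree
  \<open>N\<close> at least three times as many as those of degree \<open>N - 1\<close>: two shares
  pay for the monomials of degree \<open>h\<close> and the duals of degree \<open>N - h\<close> that
  enter, and the third is at least \<open>r\<close>, chosen larger than \<open>m\<close>. Infinitely
  many rings arise since \<open>N\<close> may grow while \<open>h\<close> stays fixed.\<close>

unbundle fps_syntax

section \<open>Laurent series\<close>

text \<open>Phrased by coefficients rather than by \<open>fls_subdegree\<close>, because the zero
  series has to satisfy every bound while its subdegree is 0. The power series ring is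
  \<open>vge 0\<close>.\<close>

definition vge :: "int \<Rightarrow> 'k::zero fls \<Rightarrow> bool" where
  "vge c f \<longleftrightarrow> (\<forall>n<c. f $$ n = 0)"

lemma vge_iff_subdegree: "vge c f \<longleftrightarrow> f = 0 \<or> c \<le> fls_subdegree f"
  unfolding vge_def by (metis fls_eq0_below_subdegree fls_zero_nth fls_subdegree_geI order_less_le_trans)

lemma vge_0 [simp]: "vge c 0"
  by (simp add: vge_def)

lemma vge_mono: "vge c f \<Longrightarrow> d \<le> c \<Longrightarrow> vge d f"
  by (auto simp: vge_def)

lemma vge_add: "vge c f \<Longrightarrow> vge c g \<Longrightarrow> vge c (f + g)"
  for f :: "'k::comm_monoid_add fls"
  by (auto simp: vge_def)

lemma vge_uminus [simp]: "vge c (- f) \<longleftrightarrow> vge c f" for f :: "'k::ab_group_add fls"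
  by (auto simp: vge_def)

lemma vge_diff: "vge c f \<Longrightarrow> vge c g \<Longrightarrow> vge c (f - g)" for f :: "'k::ab_group_add fls"
  by (auto simp: vge_def)

lemma vge_sum: "(\<And>x. x \<in> A \<Longrightarrow> vge c (f x)) \<Longrightarrow> vge c (\<Sum>x\<in>A. f x)"
  for f :: "'b \<Rightarrow> 'k::comm_monoid_add fls"
  by (induction A rule: infinite_finite_induct) (auto intro: vge_add)

lemma vge_mult: "vge c f \<Longrightarrow> vge d g \<Longrightarrow> vge (c + d) (f * g)" for f g :: "'k::semiring_no_zero_divisors fls"
  by (auto simp: vge_iff_subdegree)

lemma vge_shift [simp]: "vge c (fls_shift m f) \<longleftrightarrow> vge (c + m) f"
  unfolding vge_def fls_shift_nth
proof safe
  fix n assume "\<forall>n<c. f $$ (n + m) = 0" "n < c + m"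
  then show "f $$ n = 0" by (metis add_less_cancel_right diff_add_cancel)
qed auto

lemma vge_const [simp]: "vge 0 (fls_const r)"
  by (auto simp: vge_def)

lemma vge_1 [simp]: "vge 0 (1 :: 'k::zero_neq_one fls)"
  by (auto simp: vge_def)

text \<open>Cutting off at \<open>c\<close> represents the quotient of the Laurent series by the series of order at
  least \<open>c\<close> (if \<open>b\<close>) or by zero (otherwise).\<close>

definition cut :: "bool \<Rightarrow> int \<Rightarrow> 'k::zero fls \<Rightarrow> 'k fls" where
  "cut b c f = (if b then Abs_fls (\<lambda>n. if n < c then f $$ n else 0) else f)"

lemma cut_nth [simp]: "cut b c f $$ n = (if b \<and> n \<ge> c then 0 else f $$ n)"
proof (cases b)
  case True
  have "Abs_fls (\<lambda>n. if n < c then f $$ n else 0) $$ n = (if n < c then f $$ n else 0)"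
    by (rule nth_Abs_fls_lower_bound[of "fls_subdegree f"]) auto
  with True show ?thesis by (simp add: cut_def)
qed (simp add: cut_def)

lemma cut_0 [simp]: "cut b c 0 = 0"
  by (rule fls_eqI) simp

lemma cut_add: "cut b c (f + g) = cut b c f + cut b c g" for f :: "'k::comm_monoid_add fls"
  by (rule fls_eqI) simp

lemma cut_diff: "cut b c (f - g) = cut b c f - cut b c g" for f :: "'k::ab_group_add fls"
  by (rule fls_eqI) simp

lemma cut_uminus: "cut b c (- f) = - cut b c f" for f :: "'k::ab_group_add fls"
  by (rule fls_eqI) simp

lemma cut_sum: "cut b c (\<Sum>x\<in>A. f x) = (\<Sum>x\<in>A. cut b c (f x))"
  for f :: "'b \<Rightarrow> 'k::comm_monoid_add fls"
  by (induction A rule: infinite_finite_induct) (auto simp: cut_add)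

lemma cut_idem [simp]: "cut b c (cut b c f) = cut b c f"
  by (rule fls_eqI) simp

lemma cut_eq_0_iff: "cut b c f = 0 \<longleftrightarrow> (if b then vge c f else f = 0)"
  by (auto simp: vge_def fls_eq_iff not_le)

lemma cut_shift: "cut b c (fls_shift m f) = fls_shift m (cut b (c + m) f)"
  by (rule fls_eqI) simp

text \<open>The part of \<open>g\<close> that is cut off has order at least \<open>d\<close>, so
  after multiplication by \<open>f\<close> it has order at least \<open>e\<close> and is cut off
  again. Hence multiplication is well defined on truncated representatives.\<close>

lemma cut_mult_cut:
  fixes f g :: "'k::field fls"
  assumes "vge c f" "e \<le> c + d"
  shows "cut b e (f * cut b d g) = cut b e (f * g)"
proof -
  have "cut b e (f * (g - cut b d g)) = 0"
  proof (cases b)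
    case True
    then have "vge d (g - cut b d g)" by (auto simp: vge_def)
    from vge_mono[OF vge_mult[OF assms(1) this] assms(2)] True show ?thesis
      by (simp add: cut_eq_0_iff)
  next
    case False
    then have "cut b d g = g" by (simp add: cut_def)
    then show ?thesis by simp
  qed
  then show ?thesis by (simp add: right_diff_distrib cut_diff)
qed

text \<open>The values lie in the fraction field (\<open>b\<close> false) or its quotient by the power series
  (\<open>b\<close> true), which are divisible.\<close>

lemma functional_extension:
  fixes B :: "('y, 'z) ring_scheme" (structure) and act :: "'k::field fls \<Rightarrow> 'y \<Rightarrow> 'y" and f :: "'y \<Rightarrow> 'k fls"
  assumes B: "abelian_group B"
    and act_closed: "\<And>v y. \<lbrakk>vge 0 v; y \<in> carrier B\<rbrakk> \<Longrightarrow> act v y \<in> carrier B"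
    and act_add_right: "\<And>v y z. \<lbrakk>vge 0 v; y \<in> carrier B; z \<in> carrier B\<rbrakk> \<Longrightarrow> act v (y \<oplus> z) = act v y \<oplus> act v z"
    and act_add_left: "\<And>v w y. \<lbrakk>vge 0 v; vge 0 w; y \<in> carrier B\<rbrakk> \<Longrightarrow> act (v + w) y = act v y \<oplus> act w y"
    and act_mult: "\<And>v w y. \<lbrakk>vge 0 v; vge 0 w; y \<in> carrier B\<rbrakk> \<Longrightarrow> act (v * w) y = act v (act w y)"
    and act_1: "\<And>y. y \<in> carrier B \<Longrightarrow> act 1 y = y"
    and act_0: "\<And>y. y \<in> carrier B \<Longrightarrow> act 0 y = \<zero>"
    and N: "N \<subseteq> carrier B" "\<zero> \<in> N" "\<And>y z. y \<in> N \<Longrightarrow> z \<in> N \<Longrightarrow> y \<oplus> z \<in> N"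
      "\<And>v y. vge 0 v \<Longrightarrow> y \<in> N \<Longrightarrow> act v y \<in> N"
    and f: "\<And>y. y \<in> N \<Longrightarrow> cut b 0 (f y) = f y" "\<And>y z. y \<in> N \<Longrightarrow> z \<in> N \<Longrightarrow> f (y \<oplus> z) = f y + f z"
      "\<And>v y. vge 0 v \<Longrightarrow> y \<in> N \<Longrightarrow> f (act v y) = cut b 0 (v * f y)"
  shows "\<exists>g. (\<forall>y\<in>carrier B. cut b 0 (g y) = g y) \<and>
    (\<forall>y\<in>carrier B. \<forall>z\<in>carrier B. g (y \<oplus> z) = g y + g z) \<and>
    (\<forall>v. \<forall>y\<in>carrier B. vge 0 v \<longrightarrow> g (act v y) = cut b 0 (v * g y)) \<and> (\<forall>y\<in>N. g y = f y)"
proof -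
  interpret abelian_group B by (rule B)
  \<comment> \<open>Partial extensions are handled as graphs in Zorn's lemma. Since these are closed
    under sums and scalars, having only 0 above zero amounts to being single-valued.\<close>
  define graphs where "graphs = {H. H \<subseteq> carrier B \<times> {d. cut b 0 d = d} \<and> (\<lambda>y. (y, f y)) ` N \<subseteq> H \<and>
    (\<forall>y d z e. (y, d) \<in> H \<longrightarrow> (z, e) \<in> H \<longrightarrow> (y \<oplus> z, d + e) \<in> H) \<and>
    (\<forall>v y d. vge 0 v \<longrightarrow> (y, d) \<in> H \<longrightarrow> (act v y, cut b 0 (v * d)) \<in> H) \<and>
    (\<forall>d. (\<zero>, d) \<in> H \<longrightarrow> d = 0)}"
  have "f (\<zero> \<oplus> \<zero>) = f \<zero> + f \<zero>" using N(2) by (rule f(2)[OF _ N(2)])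
  then have f0: "f \<zero> = 0" by (metis add_left_imp_eq add.right_neutral l_zero zero_closed)
  have "(\<lambda>y. (y, f y)) ` N \<in> graphs"
    using N f f0 by (auto simp: graphs_def)
  then have ne: "graphs \<noteq> {}" by auto
  have chain: "\<Union>C \<in> graphs" if C: "C \<noteq> {}" "subset.chain graphs C" for C
  proof -
    have C_graphs: "H \<in> graphs" if "H \<in> C" for H
      using C(2) that by (auto simp: subset.chain_def)
    have common: "\<exists>H\<in>C. p \<in> H \<and> q \<in> H" if "p \<in> \<Union>C" "q \<in> \<Union>C" for p q
    proof -
      from that obtain H1 H2 where "H1 \<in> C" "p \<in> H1" "H2 \<in> C" "q \<in> H2" by auto
      moreover from this have "H1 \<subseteq> H2 \<or> H2 \<subseteq> H1"
        using C(2) unfolding subset_chain_def by auto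
      ultimately show ?thesis by auto
    qed
    have "(y \<oplus> z, d + e) \<in> \<Union>C" if "(y, d) \<in> \<Union>C" "(z, e) \<in> \<Union>C" for y d z e
    proof -
      obtain H where "H \<in> C" "(y, d) \<in> H" "(z, e) \<in> H" using common \<open>(y, d) \<in> \<Union>C\<close> \<open>(z, e) \<in> \<Union>C\<close> by blast
      moreover from this C_graphs have "(y \<oplus> z, d + e) \<in> H" by (auto simp: graphs_def)
      ultimately show ?thesis by auto
    qed
    moreover have "(act v y, cut b 0 (v * d)) \<in> \<Union>C" if "vge 0 v" "(y, d) \<in> \<Union>C" for v y d
      using that C_graphs by (auto simp: graphs_def) blast
    moreover have "\<Union>C \<subseteq> carrier B \<times> {d. cut b 0 d = d}"
      using C_graphs unfolding graphs_def by blast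
    moreover have "(\<lambda>y. (y, f y)) ` N \<subseteq> \<Union>C"
    proof -
      obtain H where "H \<in> C" using C(1) by blast
      moreover from C_graphs[OF this] have "(\<lambda>y. (y, f y)) ` N \<subseteq> H" by (simp add: graphs_def)
      ultimately show ?thesis by blast
    qed
    moreover have "d = 0" if d: "(\<zero>, d) \<in> \<Union>C" for d
    proof -
      obtain H where "H \<in> C" "(\<zero>, d) \<in> H" using d by blast
      with C_graphs[of H] show ?thesis by (simp add: graphs_def)
    qed
    ultimately show ?thesis unfolding graphs_def by simp
  qed
  obtain H where H: "H \<in> graphs" and max: "\<And>H'. H' \<in> graphs \<Longrightarrow> H \<subseteq> H' \<Longrightarrow> H' = H"
    using subset_Zorn_nonempty[OF ne chain] by blast
  have H_sub: "\<And>y d. (y, d) \<in> H \<Longrightarrow> y \<in> carrier B \<and> cut b 0 d = d"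
    and H_f: "\<And>y. y \<in> N \<Longrightarrow> (y, f y) \<in> H"
    and H_add: "\<And>y d z e. (y, d) \<in> H \<Longrightarrow> (z, e) \<in> H \<Longrightarrow> (y \<oplus> z, d + e) \<in> H"
    and H_act: "\<And>v y d. vge 0 v \<Longrightarrow> (y, d) \<in> H \<Longrightarrow> (act v y, cut b 0 (v * d)) \<in> H"
    and H_0: "\<And>d. (\<zero>, d) \<in> H \<Longrightarrow> d = 0"
    using H by (auto simp: graphs_def)
  have H_zero: "(\<zero>, 0) \<in> H" using H_f[OF N(2)] f0 by simp
  have act_m1: "act (- 1) y = \<ominus> y" if "y \<in> carrier B" for y
    using act_add_left[of "-1" 1 y] act_1[OF that] act_0[OF that] act_closed[of "-1" y] that
    by (intro minus_equality[symmetric]) simp_all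
  have total: "\<exists>d. (y, d) \<in> H" if y: "y \<in> carrier B" for y
  proof (rule ccontr)
    assume ny: "\<not> ?thesis"
    \<comment> \<open>The exponents \<open>n\<close> for which \<open>x ^ n y\<close> already lies
      in the domain. A value \<open>e\<close> at \<open>y\<close> is consistent as soon as it is
      right for the least such \<open>n\<close>: it is the prescribed value divided by
      \<open>x ^ n\<close>, where divisibility of the target enters. If there is no such
      \<open>n\<close>, the value 0 will do.\<close>
    define P where "P = (\<lambda>n. \<exists>d. (act (fls_X ^ n) y, d) \<in> H)"
    have X: "vge 0 (fls_X ^ n :: 'k fls)" for n by (auto simp: vge_iff_subdegree)
    have "\<exists>n e. cut b 0 e = e \<and> (\<forall>k. P k \<longrightarrow> n \<le> k \<and> (act (fls_X ^ n) y, cut b 0 (fls_X ^ n * e)) \<in> H)"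
    proof (cases "\<exists>n. P n")
      case True
      define n where "n = (LEAST n. P n)"
      have "P n" using True unfolding n_def by (metis LeastI)
      then obtain d where d: "(act (fls_X ^ n) y, d) \<in> H" by (auto simp: P_def)
      define e where "e = cut b 0 (inverse (fls_X ^ n) * d)"
      have "cut b 0 (fls_X ^ n * e) = cut b 0 (fls_X ^ n * (inverse (fls_X ^ n) * d))"
        unfolding e_def by (rule cut_mult_cut[OF X]) simp
      also have "\<dots> = d" using H_sub[OF d] by (simp flip: mult.assoc)
      finally show ?thesis
        using d by (intro exI[of _ n] exI[of _ e]) (auto simp: e_def n_def Least_le)
    next
      case False
      then show ?thesis by (intro exI[of _ 0] exI[of _ "0 :: 'k fls"]) simp
    qed
    then obtain n e where e: "cut b 0 e = e"
      and ne: "\<And>k. P k \<Longrightarrow> n \<le> k \<and> (act (fls_X ^ n) y, cut b 0 (fls_X ^ n * e)) \<in> H" by blast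
    define H' where "H' = {(z \<oplus> act v y, d + cut b 0 (v * e)) | z v d. (z, d) \<in> H \<and> vge 0 v}"
    have H'I: "(z \<oplus> act v y, d + cut b 0 (v * e)) \<in> H'" if "(z, d) \<in> H" "vge 0 v" for z d v
      using that by (auto simp: H'_def)
    have H'E: "\<exists>z v d. y' = z \<oplus> act v y \<and> d' = d + cut b 0 (v * e) \<and> (z, d) \<in> H \<and> vge 0 v"
      if "(y', d') \<in> H'" for y' d'
      using that by (auto simp: H'_def)
    have "H \<subseteq> H'"
    proof clarify
      fix z d assume zd: "(z, d) \<in> H"
      then show "(z, d) \<in> H'"
        using H'I[OF zd, of 0] H_sub[OF zd] y by (simp add: act_0)
    qed
    moreover have "(y, e) \<in> H'"
      using H'I[OF H_zero, of 1] y e by (simp add: act_1)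
    moreover have "H' \<in> graphs"
    proof -
      have "H' \<subseteq> carrier B \<times> {d. cut b 0 d = d}"
        using H_sub y by (auto simp: H'_def act_closed cut_add)
      moreover have "(\<lambda>y. (y, f y)) ` N \<subseteq> H'"
        using \<open>H \<subseteq> H'\<close> H_f by auto
      moreover have "(y1 \<oplus> y2, d1 + d2) \<in> H'" if "(y1, d1) \<in> H'" "(y2, d2) \<in> H'" for y1 d1 y2 d2
      proof -
        from H'E[OF that(1)] obtain z1 v1 c1 where 1: "y1 = z1 \<oplus> act v1 y"
          "d1 = c1 + cut b 0 (v1 * e)" "(z1, c1) \<in> H" "vge 0 v1" by blast
        from H'E[OF that(2)] obtain z2 v2 c2 where 2: "y2 = z2 \<oplus> act v2 y"
          "d2 = c2 + cut b 0 (v2 * e)" "(z2, c2) \<in> H" "vge 0 v2" by blast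
        have "z1 \<in> carrier B" "z2 \<in> carrier B" "act v1 y \<in> carrier B" "act v2 y \<in> carrier B"
          using 1 2 H_sub y act_closed by auto
        then have "y1 \<oplus> y2 = (z1 \<oplus> z2) \<oplus> act (v1 + v2) y"
          using 1 2 y by (simp add: act_add_left a_ac)
        moreover have "d1 + d2 = (c1 + c2) + cut b 0 ((v1 + v2) * e)"
          using 1 2 by (simp add: distrib_right cut_add)
        ultimately show ?thesis
          using H'I[OF H_add[OF 1(3) 2(3)] vge_add[OF 1(4) 2(4)]] by simp
      qed
      moreover have "(act w y1, cut b 0 (w * d1)) \<in> H'" if w: "vge 0 w" and "(y1, d1) \<in> H'" for w y1 d1
      proof -
        from H'E[OF that(2)] obtain z1 v1 c1 where 1: "y1 = z1 \<oplus> act v1 y"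
          "d1 = c1 + cut b 0 (v1 * e)" "(z1, c1) \<in> H" "vge 0 v1" by blast
        have "act w y1 = act w z1 \<oplus> act (w * v1) y"
          using 1 w y H_sub[OF 1(3)] by (simp add: act_add_right act_mult act_closed)
        moreover have "cut b 0 (w * d1) = cut b 0 (w * c1) + cut b 0 (w * v1 * e)"
          using cut_mult_cut[OF w, of 0 0 b "v1 * e"] 1 by (simp add: distrib_left cut_add mult.assoc)
        ultimately show ?thesis
          using H'I[OF H_act[OF w 1(3)], of "w * v1"] vge_mult[OF w 1(4)] by simp
      qed
      moreover have "d1 = 0" if "(\<zero>, d1) \<in> H'" for d1
      proof -
        from H'E[OF that] obtain z v d where 1: "\<zero> = z \<oplus> act v y"
          "d1 = d + cut b 0 (v * e)" "(z, d) \<in> H" "vge 0 v" by blast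
        have z: "z \<in> carrier B" using H_sub 1 by blast
        show ?thesis
        proof (cases "v = 0")
          case True
          with 1 z y have "z = \<zero>" by (simp add: act_0)
          with 1 True H_0 show ?thesis by simp
        next
          case False
          \<comment> \<open>Here \<open>v\<close> is a unit times \<open>x ^ k\<close>. As
            \<open>v y = - z\<close> lies in the domain, so does \<open>x ^ k y\<close>. Hence
            \<open>n \<le> k\<close>, so \<open>v\<close> is a multiple of \<open>x ^ n\<close> and
            the value at \<open>v y\<close> is the expected one.\<close>
          define k where "k = nat (fls_subdegree v)"
          have k: "int k = fls_subdegree v" using 1(4) False by (simp add: k_def vge_iff_subdegree)
          define u where "u = v * inverse (fls_X ^ k)"
          have u: "vge 0 (inverse u)" "inverse u * v = fls_X ^ k"
            using False k by (auto simp: u_def vge_iff_subdegree)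
          have "act v y = \<ominus> z"
            using 1(1) z y act_closed[OF 1(4) y] by (metis minus_equality a_comm minus_minus)
          then have "act v y = act (- 1) z" using act_m1[OF z] by simp
          then have "(act v y, cut b 0 (- 1 * d)) \<in> H" using H_act[OF _ 1(3), of "-1"] by simp
          from H_act[OF u(1) this] have "P k"
            using act_mult[OF u(1) 1(4) y] by (auto simp: P_def u(2))
          note n = ne[OF this]
          define w where "w = v * inverse (fls_X ^ n)"
          have w: "vge 0 w" "w * fls_X ^ n = v"
            using False k n by (auto simp: w_def vge_iff_subdegree)
          have "(act v y, cut b 0 (w * cut b 0 (fls_X ^ n * e))) \<in> H"
            using H_act[OF w(1), of "act (fls_X ^ n) y"] n act_mult[OF w(1) X[of n] y] w(2) by simp
          moreover have "cut b 0 (w * cut b 0 (fls_X ^ n * e)) = cut b 0 (v * e)"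
            using cut_mult_cut[OF w(1), of 0 0 b "fls_X ^ n * e"] w(2) by (simp flip: mult.assoc)
          ultimately have "(act v y, cut b 0 (v * e)) \<in> H" by simp
          from H_add[OF 1(3) this] show ?thesis using 1(1,2) H_0 by simp
        qed
      qed
      ultimately show ?thesis unfolding graphs_def by blast
    qed
    ultimately have "(y, e) \<in> H" using max by blast
    with ny show False by blast
  qed
  have unique: "d = e" if "(y, d) \<in> H" "(y, e) \<in> H" for y d e
  proof -
    have "y \<in> carrier B" using H_sub that by blast
    moreover have "(act (- 1) y, cut b 0 (- 1 * e)) \<in> H" using that(2) by (intro H_act) auto
    ultimately have "(\<zero>, d + - e) \<in> H"
      using H_add[OF that(1), of "act (- 1) y" "- e"] H_sub[OF that(2)]
      by (simp add: act_m1 r_neg cut_uminus)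
    from H_0[OF this] show ?thesis by simp
  qed
  define g where "g = (\<lambda>y. SOME d. (y, d) \<in> H)"
  have g: "(y, g y) \<in> H" if "y \<in> carrier B" for y
    unfolding g_def using total[OF that] by (rule someI_ex)
  show ?thesis
  proof (intro exI[of _ g] conjI ballI allI impI)
    show "cut b 0 (g y) = g y" if "y \<in> carrier B" for y using H_sub[OF g[OF that]] by simp
    show "g (y \<oplus> z) = g y + g z" if "y \<in> carrier B" "z \<in> carrier B" for y z
      using that by (intro unique[OF g H_add[OF g g]]) auto
    show "g (act v y) = cut b 0 (v * g y)" if "y \<in> carrier B" "vge 0 v" for v y
      using that by (intro unique[OF g H_act[OF _ g]]) (auto simp: act_closed)
    show "g y = f y" if "y \<in> N" for y
      using that N(1) by (intro unique[OF g H_f]) auto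
  qed
qed

section \<open>Dimension and nilpotency\<close>

text \<open>A spanning family with dual functionals is a basis. The map \<open>\<rho>\<close> is
  there because the scalars will be cosets in a residue field, whereas the coordinates live in a
  type.\<close>

lemma (in vectorspace) dim_coordinates:
  fixes \<rho> :: "'a \<Rightarrow> 'k::field" and b :: "'s \<Rightarrow> 'c" and \<psi> :: "'s \<Rightarrow> 'c \<Rightarrow> 'k"
  assumes fin: "finite D" and b: "\<And>s. s \<in> D \<Longrightarrow> b s \<in> carrier V"
    and add: "\<And>s x y. \<lbrakk>s \<in> D; x \<in> carrier V; y \<in> carrier V\<rbrakk> \<Longrightarrow> \<psi> s (x \<oplus>\<^bsub>V\<^esub> y) = \<psi> s x + \<psi> s y"
    and scale: "\<And>s k x. \<lbrakk>s \<in> D; k \<in> carrier K; x \<in> carrier V\<rbrakk> \<Longrightarrow> \<psi> s (k \<odot>\<^bsub>V\<^esub> x) = \<rho> k * \<psi> s x"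
    and inj: "\<And>k. \<lbrakk>k \<in> carrier K; \<rho> k = 0\<rbrakk> \<Longrightarrow> k = \<zero>\<^bsub>K\<^esub>"
    and dual: "\<And>s t. \<lbrakk>s \<in> D; t \<in> D\<rbrakk> \<Longrightarrow> \<psi> s (b t) = (if s = t then 1 else 0)"
    and gen: "carrier V \<subseteq> span (b ` D)"
  shows "dim = card D"
proof -
  have sub: "b ` D \<subseteq> carrier V" using b by auto
  have inj_b: "inj_on b D"
    using dual by (intro inj_onI) (metis zero_neq_one)
  have zero: "\<psi> s \<zero>\<^bsub>V\<^esub> = 0" if "s \<in> D" for s
  proof -
    have "\<psi> s (\<zero>\<^bsub>V\<^esub> \<oplus>\<^bsub>V\<^esub> \<zero>\<^bsub>V\<^esub>) = \<psi> s \<zero>\<^bsub>V\<^esub> + \<psi> s \<zero>\<^bsub>V\<^esub>" using that by (intro add) auto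
    then show ?thesis by (metis M.r_zero M.zero_closed add_cancel_left_left)
  qed
  have lin: "\<psi> s (lincomb c A) = (\<Sum>x\<in>A. \<rho> (c x) * \<psi> s x)"
    if "s \<in> D" "finite A" "A \<subseteq> carrier V" "c \<in> A \<rightarrow> carrier K" for s c A
    using that(2-4)
  proof (induction A rule: finite_induct)
    case empty
    then show ?case using zero[OF that(1)] by (simp add: lincomb_def)
  next
    case (insert x A)
    then have "lincomb c (insert x A) = (c x \<odot>\<^bsub>V\<^esub> x) \<oplus>\<^bsub>V\<^esub> lincomb c A"
      unfolding lincomb_def by (subst M.finsum_insert) (auto simp: Pi_def)
    moreover have "c x \<odot>\<^bsub>V\<^esub> x \<in> carrier V" "lincomb c A \<in> carrier V"
      using insert by (auto intro!: lincomb_closed)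
    ultimately show ?case
      using insert that(1) by (simp add: add scale Pi_def)
  qed
  have "lin_indpt (b ` D)"
  proof (rule finite_lin_indpt2)
    fix c assume c: "c \<in> b ` D \<rightarrow> carrier K" and 0: "lincomb c (b ` D) = \<zero>\<^bsub>V\<^esub>"
    show "\<forall>v\<in>b ` D. c v = \<zero>\<^bsub>K\<^esub>"
    proof clarify
      fix s assume s: "s \<in> D"
      have "0 = (\<Sum>x\<in>b ` D. \<rho> (c x) * \<psi> s x)"
        using lin[OF s _ sub c] zero[OF s] 0 fin by simp
      also have "\<dots> = (\<Sum>t\<in>D. \<rho> (c (b t)) * \<psi> s (b t))"
        by (rule sum.reindex[OF inj_b, unfolded o_def])
      also have "\<dots> = (\<Sum>t\<in>D. if s = t then \<rho> (c (b t)) else 0)"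
        using dual[OF s] by (intro sum.cong) auto
      also have "\<dots> = \<rho> (c (b s))" using fin s by simp
      finally show "c (b s) = \<zero>\<^bsub>K\<^esub>" using c s by (intro inj) auto
    qed
  qed (use fin sub in auto)
  moreover have "gen_set (b ` D)" using gen span_is_subset2[OF sub] by auto
  ultimately have "dim = card (b ` D)"
    using fin sub by (intro dim_basis) (auto simp: basis_def)
  then show ?thesis by (simp add: card_image inj_b)
qed

text \<open>If such \<open>n\<close> are bounded, the largest one is one less than the largest index
  of a nilpotent element. This isomorphism invariant separates the rings.\<close>

definition nilpotency :: "('a, 'b) ring_scheme \<Rightarrow> nat \<Rightarrow> bool" where
  "nilpotency S n \<longleftrightarrow> (\<exists>x\<in>carrier S. x [^]\<^bsub>S\<^esub> n \<noteq> \<zero>\<^bsub>S\<^esub> \<and> (\<exists>k::nat. x [^]\<^bsub>S\<^esub> k = \<zero>\<^bsub>S\<^esub>))"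

lemma nilpotency_iso:
  assumes "ring S" "ring T" "S \<simeq> T" "nilpotency S n"
  shows "nilpotency T n"
proof -
  from assms(3) obtain \<phi> where iso: "\<phi> \<in> ring_iso S T" by (auto simp: is_ring_iso_def)
  then have hom: "\<phi> \<in> ring_hom S T" and inj: "inj_on \<phi> (carrier S)"
    by (auto simp: ring_iso_def bij_betw_def)
  interpret \<phi>: ring_hom_ring S T \<phi>
    using assms(1,2) hom by (rule ring_hom_ringI2)
  from assms(4) obtain x k where x: "x \<in> carrier S" "x [^]\<^bsub>S\<^esub> n \<noteq> \<zero>\<^bsub>S\<^esub>" "x [^]\<^bsub>S\<^esub> (k::nat) = \<zero>\<^bsub>S\<^esub>"
    by (auto simp: nilpotency_def)
  have pow: "\<phi> x [^]\<^bsub>T\<^esub> j = \<phi> (x [^]\<^bsub>S\<^esub> j)" for j :: nat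
    using x(1) by (induction j) auto
  have "\<phi> (x [^]\<^bsub>S\<^esub> n) \<noteq> \<phi> \<zero>\<^bsub>S\<^esub>"
    using x(1,2) inj_on_eq_iff[OF inj, of "x [^]\<^bsub>S\<^esub> n" "\<zero>\<^bsub>S\<^esub>"] by simp
  then show ?thesis
    unfolding nilpotency_def using x(1,3) by (intro bexI[of _ "\<phi> x"] conjI exI[of _ k]) (simp_all add: pow)
qed

section \<open>Coding by power series\<close>

text \<open>Each coefficient of each series of the family is stored at a position coding a finite
  set and an integer. The coding is additive, so the sum in every module below can be the sum of
  power series.\<close>

definition enc :: "(nat set \<Rightarrow> 'k::zero fls) \<Rightarrow> 'k fps" where
  "enc F = Abs_fps (\<lambda>k. F (set_decode (fst (prod_decode k))) $$ int_decode (snd (prod_decode k)))"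

lemma enc_nth: "enc F $ prod_encode (set_encode S, int_encode n) = F S $$ n" if "finite S"
  using that by (simp add: enc_def)

lemma enc_0 [simp]: "enc (\<lambda>_. 0) = 0"
  by (auto simp: enc_def fps_eq_iff)

lemma enc_add: "enc F + enc G = enc (\<lambda>S. F S + G S)"
  by (auto simp: enc_def fps_eq_iff)

lemma enc_diff: "enc F - enc G = enc (\<lambda>S. F S - G S)" for F :: "nat set \<Rightarrow> 'k::ab_group_add fls"
  by (auto simp: enc_def fps_eq_iff)

lemma enc_uminus: "- enc F = enc (\<lambda>S. - F S)" for F :: "nat set \<Rightarrow> 'k::ab_group_add fls"
  by (auto simp: enc_def fps_eq_iff)

lemma enc_eqD: "enc F = enc G \<Longrightarrow> finite S \<Longrightarrow> F S = G S"
  by (rule fls_eqI) (metis enc_nth)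

section \<open>The algebra\<close>

text \<open>An element is the family of its coefficients with respect to squarefree monomials, indexed by
  the sets in \<open>\<A>\<close>; a product of two monomials is zero unless their index sets are disjoint and have
  a union in \<open>\<A>\<close>. The coefficients of the elements of the ring at \<open>S\<close> are the series of order at least
  \<open>a S\<close>, and \<open>a_compl\<close> makes the coefficient at \<open>\<Omega>\<close> of the product a perfect pairing.\<close>

locale monomial_datum =
  fixes \<Omega> :: "nat set" and \<A> :: "nat set set" and a :: "nat set \<Rightarrow> int"
  assumes fin_Omega: "finite \<Omega>"
    and adm_sub: "\<A> \<subseteq> Pow \<Omega>" and empty_adm: "{} \<in> \<A>"
    and adm_compl: "S \<in> \<A> \<Longrightarrow> \<Omega> - S \<in> \<A>"
    and adm_union: "\<lbrakk>S \<in> \<A>; T \<in> \<A>; U \<in> \<A>; S \<inter> T = {}; (S \<union> T) \<inter> U = {}; S \<union> T \<union> U \<in> \<A>\<rbrakk>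
      \<Longrightarrow> S \<union> T \<in> \<A>"
    and a_empty: "a {} = 0" and a_compl: "S \<in> \<A> \<Longrightarrow> a (\<Omega> - S) = - a S"
    and a_union: "\<lbrakk>S \<in> \<A>; T \<in> \<A>; S \<inter> T = {}; S \<union> T \<in> \<A>\<rbrakk> \<Longrightarrow> a (S \<union> T) \<le> a S + a T"
begin

lemma fin_adm: "finite \<A>" and finite_mem_adm: "S \<in> \<A> \<Longrightarrow> finite S"
  and adm_subset_Omega: "S \<in> \<A> \<Longrightarrow> S \<subseteq> \<Omega>"
  using adm_sub fin_Omega by (auto intro: finite_subset)

lemma Omega_adm: "\<Omega> \<in> \<A>"
  using adm_compl[OF empty_adm] by simp

lemma a_Omega: "a \<Omega> = 0"
  using a_compl[OF empty_adm] a_empty by simp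

definition Q :: "(nat set \<Rightarrow> complex fls) set" where
  "Q = {F. \<forall>S. S \<notin> \<A> \<longrightarrow> F S = 0}"

definition conv :: "(nat set \<Rightarrow> complex fls) \<Rightarrow> (nat set \<Rightarrow> complex fls) \<Rightarrow> nat set \<Rightarrow> complex fls"
    (infixl \<open>\<star>\<close> 70) where
  "(F \<star> G) = (\<lambda>U. if U \<in> \<A> then \<Sum>S\<in>Pow U. F S * G (U - S) else 0)"

text \<open>A lattice over the power series ring, spanned by scaled monomials. The ring, its maximal
  ideal and the relevant powers all have this shape, which reduces statements about ideals to
  integer inequalities.\<close>

definition lat :: "(nat set \<Rightarrow> int) \<Rightarrow> (nat set \<Rightarrow> complex fls) set" where
  "lat c = {F \<in> Q. \<forall>S\<in>\<A>. vge (c S) (F S)}"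

definition mon :: "nat set \<Rightarrow> complex fls \<Rightarrow> nat set \<Rightarrow> complex fls" where
  "mon S f = (\<lambda>T. if T = S then f else 0)"

lemma QI: "(\<And>S. S \<notin> \<A> \<Longrightarrow> F S = 0) \<Longrightarrow> F \<in> Q"
  and QD: "F \<in> Q \<Longrightarrow> S \<notin> \<A> \<Longrightarrow> F S = 0"
  by (auto simp: Q_def)

lemma latI: "F \<in> Q \<Longrightarrow> (\<And>S. S \<in> \<A> \<Longrightarrow> vge (c S) (F S)) \<Longrightarrow> F \<in> lat c"
  and lat_Q: "F \<in> lat c \<Longrightarrow> F \<in> Q" and lat_vge: "F \<in> lat c \<Longrightarrow> vge (c S) (F S)"
  by (cases "S \<in> \<A>"; auto simp: lat_def Q_def)+

lemma Q_closed [simp, intro]: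
  "(\<lambda>_. 0) \<in> Q" "F \<in> Q \<Longrightarrow> G \<in> Q \<Longrightarrow> (\<lambda>S. F S + G S) \<in> Q"
  "F \<in> Q \<Longrightarrow> G \<in> Q \<Longrightarrow> (\<lambda>S. F S - G S) \<in> Q" "F \<in> Q \<Longrightarrow> (\<lambda>S. - F S) \<in> Q"
  "F \<star> G \<in> Q" "S \<in> \<A> \<Longrightarrow> mon S f \<in> Q"
  by (auto simp: Q_def conv_def mon_def)

lemma lat_closed:
  "(\<lambda>_. 0) \<in> lat c" "F \<in> lat c \<Longrightarrow> G \<in> lat c \<Longrightarrow> (\<lambda>S. F S + G S) \<in> lat c"
  "F \<in> lat c \<Longrightarrow> G \<in> lat c \<Longrightarrow> (\<lambda>S. F S - G S) \<in> lat c" "F \<in> lat c \<Longrightarrow> (\<lambda>S. - F S) \<in> lat c"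
  "S \<in> \<A> \<Longrightarrow> vge (c S) f \<Longrightarrow> mon S f \<in> lat c"
  by (auto simp: lat_def vge_add vge_diff) (simp add: mon_def)

lemma lat_mono: "(\<And>S. S \<in> \<A> \<Longrightarrow> d S \<le> c S) \<Longrightarrow> lat c \<subseteq> lat d"
  by (auto simp: lat_def intro: vge_mono)

lemma conv_lat:
  assumes F: "F \<in> lat c" and G: "G \<in> lat d"
    and cde: "\<And>S T. \<lbrakk>S \<in> \<A>; T \<in> \<A>; S \<inter> T = {}; S \<union> T \<in> \<A>\<rbrakk> \<Longrightarrow> e (S \<union> T) \<le> c S + d T"
  shows "F \<star> G \<in> lat e"
proof (rule latI)
  fix U assume U: "U \<in> \<A>"
  have "vge (e U) (F S * G (U - S))" if S: "S \<subseteq> U" for S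
  proof (cases "S \<in> \<A> \<and> U - S \<in> \<A>")
    case True
    have "e (S \<union> (U - S)) \<le> c S + d (U - S)"
      using True S U by (intro cde) (auto simp: Un_absorb1)
    moreover have "S \<union> (U - S) = U" using S by auto
    ultimately show ?thesis
      using vge_mono[OF vge_mult[OF lat_vge[OF F] lat_vge[OF G]]] by metis
  next
    case False
    then have "F S = 0 \<or> G (U - S) = 0" using F G lat_Q QD by blast
    then show ?thesis by auto
  qed
  then show "vge (e U) ((F \<star> G) U)"
    using U by (auto simp: conv_def intro!: vge_sum)
qed auto

lemma conv_comm: "F \<star> G = G \<star> F"
proof
  fix U
  have "(\<Sum>S\<in>Pow U. F S * G (U - S)) = (\<Sum>S\<in>Pow U. G S * F (U - S))" if "U \<in> \<A>"
    by (rule sum.reindex_bij_witness[of _ "\<lambda>S. U - S" "\<lambda>S. U - S"]) (auto simp: double_diff)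
  then show "(F \<star> G) U = (G \<star> F) U" by (simp add: conv_def)
qed

text \<open>Both sides are sums over the ordered partitions of \<open>U\<close> into three parts. By
  \<open>adm_union\<close>, when all three parts and \<open>U\<close> are admissible, so are the
  intermediate unions, and truncating the inner product loses no term.\<close>

lemma conv_assoc:
  assumes F: "F \<in> Q" and G: "G \<in> Q" and H: "H \<in> Q"
  shows "(F \<star> G) \<star> H = F \<star> (G \<star> H)"
proof
  fix U
  show "((F \<star> G) \<star> H) U = (F \<star> (G \<star> H)) U"
  proof (cases "U \<in> \<A>")
    case True
    then have fU: "finite U" by (rule finite_mem_adm)
    have *: "(F \<star> G) S * H (U - S) = (\<Sum>T\<in>Pow S. F T * G (S - T) * H (U - S))" if S: "S \<subseteq> U" for S
    proof (cases "S \<in> \<A>")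
      case False
      have "F T * G (S - T) * H (U - S) = 0" if T: "T \<subseteq> S" for T
      proof (rule ccontr)
        assume "\<not> ?thesis"
        then have "T \<in> \<A>" "S - T \<in> \<A>" "U - S \<in> \<A>" using QD[OF F] QD[OF G] QD[OF H] by auto
        moreover have "T \<union> (S - T) = S" "S \<union> (U - S) = U" using T S by auto
        ultimately have "S \<in> \<A>" using adm_union[of T "S - T" "U - S"] True by auto
        with False show False ..
      qed
      then have "(\<Sum>T\<in>Pow S. F T * G (S - T) * H (U - S)) = 0" by (intro sum.neutral) auto
      with False show ?thesis by (simp add: conv_def)
    qed (simp add: conv_def sum_distrib_right)
    have **: "F T * (G \<star> H) (U - T) = (\<Sum>W\<in>Pow (U - T). F T * G W * H (U - T - W))" if T: "T \<subseteq> U" for T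
    proof (cases "U - T \<in> \<A>")
      case False
      have "F T * G W * H (U - T - W) = 0" if W: "W \<subseteq> U - T" for W
      proof (rule ccontr)
        assume "\<not> ?thesis"
        then have "T \<in> \<A>" "W \<in> \<A>" "U - T - W \<in> \<A>" using QD[OF F] QD[OF G] QD[OF H] by auto
        moreover have "W \<union> (U - T - W) = U - T" "(U - T) \<union> T = U" using T W by auto
        ultimately have "U - T \<in> \<A>" using adm_union[of W "U - T - W" T] True by auto
        with False show False ..
      qed
      then have "(\<Sum>W\<in>Pow (U - T). F T * G W * H (U - T - W)) = 0" by (intro sum.neutral) auto
      with False show ?thesis by (simp add: conv_def)
    qed (simp add: conv_def sum_distrib_left mult.assoc)
    have "((F \<star> G) \<star> H) U = (\<Sum>S\<in>Pow U. \<Sum>T\<in>Pow S. F T * G (S - T) * H (U - S))"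
      using True * by (simp add: conv_def[of "F \<star> G"])
    also have "\<dots> = (\<Sum>(S,T)\<in>(SIGMA S:Pow U. Pow S). F T * G (S - T) * H (U - S))"
      by (rule sum.Sigma) (use fU in \<open>auto intro: finite_subset\<close>)
    also have "\<dots> = (\<Sum>(T,W)\<in>(SIGMA T:Pow U. Pow (U - T)). F T * G W * H (U - T - W))"
    proof (rule sum.reindex_bij_witness[of _ "\<lambda>(T,W). (T \<union> W, T)" "\<lambda>(S,T). (T, S - T)"])
      fix p assume "p \<in> (SIGMA S:Pow U. Pow S)"
      then obtain S T where p: "p = (S, T)" "T \<subseteq> S" "S \<subseteq> U" by auto
      then have "U - T - (S - T) = U - S" by auto
      with p show "(case (case p of (S, T) \<Rightarrow> (T, S - T)) of (T, W) \<Rightarrow> F T * G W * H (U - T - W))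
          = (case p of (S, T) \<Rightarrow> F T * G (S - T) * H (U - S))" by simp
    qed auto
    also have "\<dots> = (\<Sum>T\<in>Pow U. \<Sum>W\<in>Pow (U - T). F T * G W * H (U - T - W))"
      by (rule sum.Sigma[symmetric]) (use fU in \<open>auto intro: finite_subset\<close>)
    also have "\<dots> = (F \<star> (G \<star> H)) U"
      using True ** by (simp add: conv_def[of F "G \<star> H"])
    finally show ?thesis .
  qed (simp add: conv_def)
qed

lemma conv_add_left: "(\<lambda>S. F S + G S) \<star> H = (\<lambda>S. (F \<star> H) S + (G \<star> H) S)"
  and conv_add_right: "H \<star> (\<lambda>S. F S + G S) = (\<lambda>S. (H \<star> F) S + (H \<star> G) S)"
  by (auto simp: conv_def fun_eq_iff sum.distrib algebra_simps)

lemma mon_conv: "(mon S f \<star> G) U = (if U \<in> \<A> \<and> S \<subseteq> U then f * G (U - S) else 0)"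
proof -
  have "(\<Sum>T\<in>Pow U. mon S f T * G (U - T)) = (\<Sum>T\<in>Pow U. if T = S then f * G (U - S) else 0)"
    by (rule sum.cong) (auto simp: mon_def)
  then show ?thesis by (auto simp: conv_def finite_mem_adm)
qed

lemma mon_empty_conv: "G \<in> Q \<Longrightarrow> mon {} f \<star> G = (\<lambda>S. f * G S)"
  by (auto simp: mon_conv QD fun_eq_iff)

lemma mon_conv_mon:
  assumes "S \<inter> T = {}" "S \<union> T \<in> \<A>"
  shows "mon S f \<star> mon T g = mon (S \<union> T) (f * g)"
proof
  fix U
  have "S \<subseteq> U \<and> U - S = T \<longleftrightarrow> U = S \<union> T" using assms(1) by auto
  then show "(mon S f \<star> mon T g) U = mon (S \<union> T) (f * g) U"
    using assms(2) unfolding mon_conv by (auto simp: mon_def)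
qed

text \<open>A nonempty set is not disjoint from itself. This places all nonconstant monomials in
  every prime ideal.\<close>

lemma mon_square: "S \<noteq> {} \<Longrightarrow> mon S f \<star> mon S f = (\<lambda>_. 0)"
  unfolding mon_conv fun_eq_iff by (auto simp: mon_def)

lemma mon_sum: "F \<in> Q \<Longrightarrow> (\<Sum>S\<in>\<A>. mon S (F S) T) = F T"
  using fin_adm by (auto simp: mon_def QD)

section \<open>The ring on coded families\<close>

definition dec :: "complex fps \<Rightarrow> nat set \<Rightarrow> complex fls" where
  "dec = inv_into Q enc"

lemma inj_on_enc: "inj_on enc Q"
proof (rule inj_onI, rule ext)
  fix F G S assume FG: "F \<in> Q" "G \<in> Q" "enc F = enc G"
  show "F S = G S"
    by (cases "S \<in> \<A>") (use FG in \<open>auto simp: QD finite_mem_adm intro: enc_eqD\<close>)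
qed

lemma dec_enc [simp]: "F \<in> Q \<Longrightarrow> dec (enc F) = F"
  unfolding dec_def by (rule inv_into_f_f[OF inj_on_enc])

lemma enc_eq_iff: "F \<in> Q \<Longrightarrow> G \<in> Q \<Longrightarrow> enc F = enc G \<longleftrightarrow> F = G"
  by (metis dec_enc)

lemma enc_mem_iff: "F \<in> Q \<Longrightarrow> enc F \<in> enc ` lat c \<longleftrightarrow> F \<in> lat c"
  using lat_Q by (auto simp: enc_eq_iff image_iff)

definition R :: "complex fps ring" where
  "R = \<lparr>carrier = enc ` lat a, monoid.mult = (\<lambda>u v. enc (dec u \<star> dec v)), monoid.one = enc (mon {} 1),
        ring.zero = 0, ring.add = (+)\<rparr>"

lemma R_simps [simp]:
  "carrier R = enc ` lat a" "\<one>\<^bsub>R\<^esub> = enc (mon {} 1)" "\<zero>\<^bsub>R\<^esub> = 0" "x \<oplus>\<^bsub>R\<^esub> y = x + y"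
  "F \<in> Q \<Longrightarrow> G \<in> Q \<Longrightarrow> enc F \<otimes>\<^bsub>R\<^esub> enc G = enc (F \<star> G)"
  by (auto simp: R_def)

lemma conv_lat_a: "F \<in> lat a \<Longrightarrow> G \<in> lat a \<Longrightarrow> F \<star> G \<in> lat a"
  by (rule conv_lat) (auto intro: a_union)

lemma one_lat: "mon {} 1 \<in> lat a"
  by (rule lat_closed) (auto simp: empty_adm a_empty)

lemma cring_R: "cring R"
proof (rule cringI)
  show "abelian_group R"
  proof (rule abelian_groupI)
    fix x assume "x \<in> carrier R"
    then obtain F where F: "F \<in> lat a" "x = enc F" by auto
    then have "enc (\<lambda>S. - F S) \<in> carrier R" using lat_closed by auto
    moreover have "enc (\<lambda>S. - F S) \<oplus>\<^bsub>R\<^esub> x = \<zero>\<^bsub>R\<^esub>" using F by (simp add: enc_add)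
    ultimately show "\<exists>y\<in>carrier R. y \<oplus>\<^bsub>R\<^esub> x = \<zero>\<^bsub>R\<^esub>" by blast
  next
    show "\<zero>\<^bsub>R\<^esub> \<in> carrier R" using lat_closed(1) by (auto intro!: image_eqI[of _ _ "\<lambda>_. 0"])
  next
    fix x y assume "x \<in> carrier R" "y \<in> carrier R"
    then show "x \<oplus>\<^bsub>R\<^esub> y \<in> carrier R" by (auto simp: enc_add lat_closed intro!: imageI)
  qed (auto simp: algebra_simps)
  show "Group.comm_monoid R"
    by (rule comm_monoidI)
       (auto simp: conv_lat_a one_lat lat_Q conv_assoc mon_empty_conv empty_adm
             intro!: imageI arg_cong[of _ _ enc] conv_comm)
next
  fix x y z assume "x \<in> carrier R" "y \<in> carrier R" "z \<in> carrier R"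
  then obtain F G H where *: "F \<in> Q" "x = enc F" "G \<in> Q" "y = enc G" "H \<in> Q" "z = enc H"
    by (auto dest: lat_Q)
  then show "(x \<oplus>\<^bsub>R\<^esub> y) \<otimes>\<^bsub>R\<^esub> z = x \<otimes>\<^bsub>R\<^esub> z \<oplus>\<^bsub>R\<^esub> y \<otimes>\<^bsub>R\<^esub> z"
    by (simp add: enc_add conv_add_left)
qed

interpretation R: cring R by (rule cring_R)

lemma mon_apply: "mon S f T = (if T = S then f else 0)"
  by (simp add: mon_def)

lemma mon_0 [simp]: "mon S 0 = (\<lambda>_. 0)"
  by (auto simp: mon_apply)

lemma lat_a_Q: "F \<in> lat a \<Longrightarrow> F \<in> Q"
  by (rule lat_Q)

lemma R_uminus: "x \<in> carrier R \<Longrightarrow> \<ominus>\<^bsub>R\<^esub> x = - x"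
proof -
  assume x: "x \<in> carrier R"
  then have "- x \<in> carrier R" using lat_closed(4) by (auto simp: enc_uminus)
  then show ?thesis by (intro R.minus_equality) (use x in auto)
qed

lemma ideal_encI:
  assumes J: "J \<subseteq> lat a" "(\<lambda>_. 0) \<in> J"
    and add: "\<And>F G. F \<in> J \<Longrightarrow> G \<in> J \<Longrightarrow> (\<lambda>S. F S + G S) \<in> J"
    and neg: "\<And>F. F \<in> J \<Longrightarrow> (\<lambda>S. - F S) \<in> J"
    and mult: "\<And>F G. F \<in> J \<Longrightarrow> G \<in> lat a \<Longrightarrow> G \<star> F \<in> J"
  shows "ideal (enc ` J) R"
proof (rule idealI)
  show "ring R" by (rule R.ring_axioms)
  show "subgroup (enc ` J) (add_monoid R)"
  proof (rule R.add.subgroupI)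
    show "enc ` J \<subseteq> carrier R" "enc ` J \<noteq> {}" using J by auto
  next
    fix x assume "x \<in> enc ` J"
    then show "\<ominus>\<^bsub>R\<^esub> x \<in> enc ` J"
      using J(1) neg by (auto simp: R_uminus enc_uminus)
  next
    fix x y assume "x \<in> enc ` J" "y \<in> enc ` J"
    then show "x \<oplus>\<^bsub>R\<^esub> y \<in> enc ` J" using add by (auto simp: enc_add)
  qed
next
  fix x y assume x: "x \<in> enc ` J" and y: "y \<in> carrier R"
  then obtain F G where *: "F \<in> J" "x = enc F" "G \<in> lat a" "y = enc G" by auto
  then have "F \<in> Q" "G \<in> Q" using J(1) lat_Q by auto
  with * mult show "y \<otimes>\<^bsub>R\<^esub> x \<in> enc ` J" "x \<otimes>\<^bsub>R\<^esub> y \<in> enc ` J"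
    by (auto simp: conv_comm[of F G])
qed

lemma lat_ideal:
  assumes "\<And>S. S \<in> \<A> \<Longrightarrow> a S \<le> c S"
    and "\<And>S T. \<lbrakk>S \<in> \<A>; T \<in> \<A>; S \<inter> T = {}; S \<union> T \<in> \<A>\<rbrakk> \<Longrightarrow> c (S \<union> T) \<le> a S + c T"
  shows "ideal (enc ` lat c) R"
proof (rule ideal_encI)
  show "lat c \<subseteq> lat a" using assms(1) by (rule lat_mono)
  show "G \<star> F \<in> lat c" if "F \<in> lat c" "G \<in> lat a" for F G
    using that(2,1) assms(2) by (rule conv_lat)
qed (rule lat_closed; assumption)+

section \<open>Membership of coded families in an ideal\<close>

context
  fixes I assumes I: "ideal I R"
begin

lemma ideal_elem:
  assumes "x \<in> I" obtains F where "F \<in> lat a" "x = enc F"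
  using ideal.Icarr[OF I assms] by auto

lemma ideal_zero: "enc (\<lambda>_. 0) \<in> I"
  using additive_subgroup.zero_closed[OF ideal.axioms(1)[OF I]] by simp

lemma ideal_add: "enc F \<in> I \<Longrightarrow> enc G \<in> I \<Longrightarrow> enc (\<lambda>S. F S + G S) \<in> I"
  using additive_subgroup.a_closed[OF ideal.axioms(1)[OF I]] by (simp flip: enc_add)

lemma ideal_diff: "enc F \<in> I \<Longrightarrow> enc G \<in> I \<Longrightarrow> enc (\<lambda>S. F S - G S) \<in> I"
proof -
  assume F: "enc F \<in> I" and G: "enc G \<in> I"
  from G have "\<ominus>\<^bsub>R\<^esub> enc G \<in> I"
    by (rule additive_subgroup.a_inv_closed[OF ideal.axioms(1)[OF I]])
  moreover have "\<ominus>\<^bsub>R\<^esub> enc G = - enc G"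
    using ideal.Icarr[OF I G] by (rule R_uminus)
  ultimately have "enc F \<oplus>\<^bsub>R\<^esub> (- enc G) \<in> I"
    using F additive_subgroup.a_closed[OF ideal.axioms(1)[OF I]] by metis
  then show ?thesis by (simp flip: enc_diff)
qed

lemma ideal_conv: "enc F \<in> I \<Longrightarrow> F \<in> Q \<Longrightarrow> G \<in> lat a \<Longrightarrow> enc (G \<star> F) \<in> I"
  using ideal.I_l_closed[OF I, of "enc F" "enc G"] by (simp add: lat_a_Q)

lemma ideal_scale: "enc F \<in> I \<Longrightarrow> F \<in> Q \<Longrightarrow> vge 0 v \<Longrightarrow> enc (\<lambda>S. v * F S) \<in> I"
  using ideal_conv[of F "mon {} v"] by (simp add: mon_empty_conv lat_closed empty_adm a_empty)

lemma ideal_components: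
  assumes "F \<in> Q" "\<And>S. S \<in> \<A> \<Longrightarrow> enc (mon S (F S)) \<in> I"
  shows "enc F \<in> I"
proof -
  have "enc (\<lambda>T. \<Sum>S\<in>B. mon S (F S) T) \<in> I" if "B \<subseteq> \<A>" for B
    using finite_subset[OF that fin_adm] that
  proof (induction B rule: finite_induct)
    case empty
    then show ?case using ideal_zero by simp
  next
    case (insert S B)
    then have "enc (\<lambda>T. mon S (F S) T + (\<Sum>S\<in>B. mon S (F S) T)) \<in> I"
      using insert assms(2)[of S] by (intro ideal_add) auto
    then show ?case using insert.hyps by simp
  qed
  from this[of \<A>] show ?thesis by (simp add: mon_sum[OF assms(1)])
qed

end

section \<open>Noetherianity\<close>

text \<open>Echelon form: split off an element of minimal order at one index.\<close>

lemma lat_finitely_generated: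
  assumes "finite B" and "J \<subseteq> {F \<in> lat c. \<forall>S. S \<notin> B \<longrightarrow> F S = 0}"
    and "\<And>F G v. \<lbrakk>F \<in> J; G \<in> J; vge 0 v\<rbrakk> \<Longrightarrow> (\<lambda>S. F S - v * G S) \<in> J"
  shows "\<exists>A\<subseteq>J. finite A \<and> (\<forall>W. A \<subseteq> W \<longrightarrow> (\<lambda>_. 0) \<in> W \<longrightarrow>
    (\<forall>F G v. F \<in> W \<longrightarrow> G \<in> W \<longrightarrow> vge 0 v \<longrightarrow> (\<lambda>S. F S + v * G S) \<in> W) \<longrightarrow> J \<subseteq> W)"
  using assms
proof (induction B arbitrary: J rule: finite_induct)
  case empty
  then have "J \<subseteq> {\<lambda>_. 0}" by (auto simp: fun_eq_iff)
  then show ?case by (intro exI[of _ "{}"]) auto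
next
  case (insert S B)
  define J' where "J' = {F \<in> J. F S = 0}"
  have "J' \<subseteq> {F \<in> lat c. \<forall>S. S \<notin> B \<longrightarrow> F S = 0}"
    using insert.prems(1) by (auto simp: J'_def)
  moreover have "(\<lambda>S. F S - v * G S) \<in> J'" if "F \<in> J'" "G \<in> J'" "vge 0 v" for F G v
    using that insert.prems(2) by (auto simp: J'_def)
  ultimately obtain A where A: "A \<subseteq> J'" "finite A" "\<And>W. \<lbrakk>A \<subseteq> W; (\<lambda>_. 0) \<in> W;
      \<forall>F G v. F \<in> W \<longrightarrow> G \<in> W \<longrightarrow> vge 0 v \<longrightarrow> (\<lambda>S. F S + v * G S) \<in> W\<rbrakk> \<Longrightarrow> J' \<subseteq> W"
    using insert.IH[of J'] by blast
  show ?case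
  proof (cases "J = J'")
    case True
    with A show ?thesis by blast
  next
    case False
    then obtain F1 where F1: "F1 \<in> J" "F1 S \<noteq> 0" by (auto simp: J'_def)
    \<comment> \<open>All orders at \<open>S\<close> are at least \<open>c S\<close>, so subtracting
      \<open>c S\<close> turns them into natural numbers, among which there is a least one.\<close>
    define \<nu> where "\<nu> = (\<lambda>F :: nat set \<Rightarrow> complex fls. nat (fls_subdegree (F S) - c S))"
    obtain F0 where F0: "F0 \<in> J" "F0 S \<noteq> 0" and least: "\<And>F. F \<in> J \<Longrightarrow> F S \<noteq> 0 \<Longrightarrow> \<nu> F0 \<le> \<nu> F"
      using ex_has_least_nat[of "\<lambda>F. F \<in> J \<and> F S \<noteq> 0" F1 \<nu>] F1 by blast
    have subdeg: "c S \<le> fls_subdegree (F S)" if "F \<in> J" "F S \<noteq> 0" for F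
      using lat_vge[of F c S] that insert.prems(1) by (auto simp: vge_iff_subdegree)
    have "J \<subseteq> W" if W: "insert F0 A \<subseteq> W" "(\<lambda>_. 0) \<in> W"
      "\<forall>F G v. F \<in> W \<longrightarrow> G \<in> W \<longrightarrow> vge 0 v \<longrightarrow> (\<lambda>S. F S + v * G S) \<in> W" for W
    proof
      fix F assume F: "F \<in> J"
      \<comment> \<open>Minimality of the order of \<open>F0\<close> makes this quotient a power
        series. Subtracting \<open>v\<close> times \<open>F0\<close> clears the coefficient at
        \<open>S\<close> and leads into \<open>J'\<close>.\<close>
      define v where "v = F S * inverse (F0 S)"
      have v: "vge 0 v"
      proof (cases "F S = 0")
        case False
        then have "fls_subdegree (F0 S) \<le> fls_subdegree (F S)"
          using least[OF F False] subdeg[OF F0] subdeg[OF F False] by (simp add: \<nu>_def)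
        then show ?thesis
          using False F0(2) by (auto simp: v_def vge_iff_subdegree)
      qed (simp add: v_def)
      have "(\<lambda>S. F S - v * F0 S) \<in> J'"
        using insert.prems(2)[OF F F0(1) v] F0(2) by (simp add: J'_def v_def)
      moreover have "J' \<subseteq> W" using A(3) W by blast
      ultimately have "(\<lambda>T. (F T - v * F0 T) + v * F0 T) \<in> W" using W v by blast
      then show "F \<in> W" by simp
    qed
    then show ?thesis
      using A(1,2) F0(1) by (intro exI[of _ "insert F0 A"]) (auto simp: J'_def)
  qed
qed

text \<open>Ideals are submodules over the subring of power series, of finite rank. Finitely many
  generators over this subring also generate the ideal: every ideal \<open>K\<close> containing them
  is closed under the same combinations.\<close>

lemma noetherian_R: "noetherian_ring R"
proof (rule R.noetherian_ringI)
  fix I assume I: "ideal I R"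
  define J where "J = {F \<in> lat a. enc F \<in> I}"
  have "J \<subseteq> {F \<in> lat a. \<forall>S. S \<notin> \<A> \<longrightarrow> F S = 0}"
    by (auto simp: J_def QD lat_a_Q)
  moreover have scale: "(\<lambda>S. v * G S) \<in> lat a" if "G \<in> lat a" "vge 0 v" for G v
    using conv_lat_a[OF _ that(1), of "mon {} v"] that
    by (simp add: mon_empty_conv lat_closed empty_adm a_empty lat_a_Q)
  moreover have "(\<lambda>S. F S - v * G S) \<in> J" if "F \<in> J" "G \<in> J" "vge 0 v" for F G v
    using that scale[of G v] lat_closed(3)[of F a "\<lambda>S. v * G S"]
      ideal_diff[OF I _ ideal_scale[OF I, of G v], of F] by (simp add: J_def lat_a_Q)
  ultimately obtain A where A: "A \<subseteq> J" "finite A" "\<And>W. \<lbrakk>A \<subseteq> W; (\<lambda>_. 0) \<in> W;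
      \<forall>F G v. F \<in> W \<longrightarrow> G \<in> W \<longrightarrow> vge 0 v \<longrightarrow> (\<lambda>S. F S + v * G S) \<in> W\<rbrakk> \<Longrightarrow> J \<subseteq> W"
    using lat_finitely_generated[OF fin_adm, of J a] by blast
  have sub: "enc ` A \<subseteq> carrier R" using A(1) by (auto simp: J_def)
  have "I \<subseteq> K" if K: "ideal K R" "enc ` A \<subseteq> K" for K
  proof
    define W where "W = {F \<in> lat a. enc F \<in> K}"
    have "A \<subseteq> W" using K A(1) by (auto simp: W_def J_def)
    moreover have "(\<lambda>_. 0) \<in> W" using ideal_zero[OF K(1)] lat_closed(1) by (simp add: W_def)
    moreover have "(\<lambda>S. F S + v * G S) \<in> W" if "F \<in> W" "G \<in> W" "vge 0 v" for F G v
      using that scale[of G v] lat_closed(2)[of F a "\<lambda>S. v * G S"]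
        ideal_add[OF K(1) _ ideal_scale[OF K(1), of G v], of F] by (simp add: W_def lat_a_Q)
    then have "\<forall>F G v. F \<in> W \<longrightarrow> G \<in> W \<longrightarrow> vge 0 v \<longrightarrow> (\<lambda>S. F S + v * G S) \<in> W" by blast
    ultimately have "J \<subseteq> W" by (intro A(3))
    moreover fix x assume x: "x \<in> I"
    moreover from ideal_elem[OF I x] obtain F where "F \<in> lat a" "x = enc F" .
    ultimately show "x \<in> K" by (auto simp: J_def W_def)
  qed
  moreover have "enc ` A \<subseteq> I" using A(1) by (auto simp: J_def)
  ultimately have "I = Idl\<^bsub>R\<^esub> (enc ` A)"
    using I by (auto simp: genideal_def)
  with sub A(2) show "\<exists>A\<subseteq>carrier R. finite A \<and> I = Idl\<^bsub>R\<^esub> A" by blast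
qed

section \<open>Prime ideals\<close>

text \<open>Compared with the ring itself, the only new condition is that the constant term is a
  non-unit.\<close>

definition max_order :: "nat set \<Rightarrow> int" where "max_order = a({} := 1)"

definition maximal_id :: "complex fps set" where "maximal_id = enc ` lat max_order"

text \<open>The name is justified below: this ideal is prime and lies in every prime ideal.\<close>

definition nilradical :: "complex fps set" where "nilradical = enc ` {F \<in> lat a. F {} = 0}"

lemma conv_empty: "(F \<star> G) {} = F {} * G {}"
  by (simp add: conv_def empty_adm)

lemma lat_max_order_iff: "F \<in> lat max_order \<longleftrightarrow> F \<in> lat a \<and> vge 1 (F {})"
proof -
  have "vge (max_order S) (F S) \<longleftrightarrow> vge (a S) (F S) \<and> (S = {} \<longrightarrow> vge 1 (F {}))" for S
    using vge_mono[of 1 "F {}" 0] by (auto simp: max_order_def a_empty)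
  then show ?thesis using empty_adm by (auto simp: lat_def)
qed

lemma maximal_id_ideal: "ideal maximal_id R"
  unfolding maximal_id_def
proof (rule lat_ideal)
  fix S T assume "S \<in> \<A>" "T \<in> \<A>" "S \<inter> T = {}" "S \<union> T \<in> \<A>"
  then show "max_order (S \<union> T) \<le> a S + max_order T"
    using a_union[of S T] a_empty by (auto simp: max_order_def)
qed (auto simp: max_order_def a_empty)

lemma nilradical_ideal: "ideal nilradical R"
  unfolding nilradical_def
  by (rule ideal_encI) (auto simp: lat_closed conv_lat_a conv_empty)

lemma maximal_id_iff: "F \<in> Q \<Longrightarrow> enc F \<in> maximal_id \<longleftrightarrow> F \<in> lat a \<and> vge 1 (F {})"
  by (simp add: maximal_id_def enc_mem_iff lat_max_order_iff)

lemma nilradical_iff: "F \<in> Q \<Longrightarrow> enc F \<in> nilradical \<longleftrightarrow> F \<in> lat a \<and> F {} = 0"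
  unfolding nilradical_def using lat_Q by (auto simp: enc_eq_iff image_iff)

text \<open>An element differs from its constant term by an element of \<open>nilradical\<close>.
  Ideals above \<open>nilradical\<close> are thereby governed by ideals of the power series ring,
  which leaves only two primes.\<close>

lemma const_component:
  assumes I: "ideal I R" and nilradical: "nilradical \<subseteq> I" and F: "F \<in> lat a" "enc F \<in> I"
  shows "enc (mon {} (F {})) \<in> I"
proof -
  have "enc (\<lambda>S. F S - mon {} (F {}) S) \<in> nilradical"
    using F lat_vge[OF F(1), of "{}"] lat_closed(3)[OF F(1), of "mon {} (F {})"] lat_closed(5)[OF empty_adm]
    by (subst nilradical_iff) (auto simp: lat_a_Q mon_apply)
  then have "enc (\<lambda>S. F S - (F S - mon {} (F {}) S)) \<in> I"
    using nilradical F ideal_diff[OF I] by blast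
  then show ?thesis by simp
qed

lemma one_mem_ideal:
  assumes I: "ideal I R" and nilradical: "nilradical \<subseteq> I" and F: "F \<in> lat a" "enc F \<in> I" "\<not> vge 1 (F {})"
  shows "I = carrier R"
proof -
  have "vge 0 (F {})" using lat_vge[OF F(1), of "{}"] by (simp add: a_empty)
  with F(3) have deg: "F {} \<noteq> 0" "fls_subdegree (F {}) = 0" by (auto simp: vge_iff_subdegree)
  then have "vge 0 (inverse (F {}))" by (auto simp: vge_iff_subdegree)
  then have "mon {} (inverse (F {})) \<in> lat a" by (intro lat_closed) (auto simp: empty_adm a_empty)
  then have "enc (mon {} (inverse (F {})) \<star> mon {} (F {})) \<in> I"
    by (intro ideal_conv[OF I] const_component[OF I nilradical F(1,2)]) (auto simp: empty_adm)
  then have "\<one>\<^bsub>R\<^esub> \<in> I" using deg by (simp add: mon_conv_mon empty_adm)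
  then show ?thesis by (rule ideal.one_imp_carrier[OF I])
qed

lemma maximal_id_maximal: "maximalideal maximal_id R"
proof (rule maximalidealI)
  have "enc (mon {} 1) \<notin> maximal_id" by (simp add: maximal_id_iff empty_adm vge_def mon_apply)
  then show "carrier R \<noteq> maximal_id" using R.one_closed by auto
next
  fix J assume J: "ideal J R" "maximal_id \<subseteq> J" "J \<subseteq> carrier R"
  have "nilradical \<subseteq> J" using J(2) by (auto simp: nilradical_def maximal_id_def lat_max_order_iff)
  show "J = maximal_id \<or> J = carrier R"
  proof (cases "J \<subseteq> maximal_id")
    case False
    then obtain x where x: "x \<in> J" "x \<notin> maximal_id" by auto
    from ideal_elem[OF J(1) x(1)] obtain F where F: "F \<in> lat a" "x = enc F" .
    then have "J = carrier R"
      using x by (intro one_mem_ideal[OF J(1) \<open>nilradical \<subseteq> J\<close>]) (auto simp: maximal_id_iff lat_a_Q)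
    then show ?thesis ..
  qed (use J in auto)
qed (rule maximal_id_ideal)

lemma nilradical_prime: "primeideal nilradical R"
proof (rule primeidealI)
  have "enc (mon {} 1) \<notin> nilradical" by (simp add: nilradical_iff empty_adm mon_apply)
  then show "carrier R \<noteq> nilradical" using R.one_closed by auto
next
  fix x y assume "x \<in> carrier R" "y \<in> carrier R" and xy: "x \<otimes>\<^bsub>R\<^esub> y \<in> nilradical"
  then obtain F G where *: "F \<in> lat a" "x = enc F" "G \<in> lat a" "y = enc G" by auto
  then show "x \<in> nilradical \<or> y \<in> nilradical"
    using xy by (auto simp: nilradical_iff lat_Q conv_empty)
qed (rule nilradical_ideal R.is_cring)+

context
  fixes P assumes P: "primeideal P R"
begin

interpretation P: primeideal P R by (rule P)

text \<open>The components at nonempty index sets have square zero, hence lie in \<open>P\<close>,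
  and so does their sum.\<close>

lemma nilradical_subset_prime: "nilradical \<subseteq> P"
proof
  fix x assume "x \<in> nilradical"
  then obtain F where F: "F \<in> lat a" "F {} = 0" "x = enc F" by (auto simp: nilradical_def)
  have "enc (mon S (F S)) \<in> P" if S: "S \<in> \<A>" for S
  proof (cases "S = {}")
    case True
    then show ?thesis using ideal_zero[OF P.is_ideal] F(2) by simp
  next
    case False
    have "mon S (F S) \<in> lat a" using S F(1) lat_vge by (auto intro: lat_closed)
    moreover then have "enc (mon S (F S)) \<otimes>\<^bsub>R\<^esub> enc (mon S (F S)) \<in> P"
      using False S ideal_zero[OF P.is_ideal] by (simp add: mon_square)
    ultimately show ?thesis using P.I_prime by auto
  qed
  then show "x \<in> P" using F by (auto intro: ideal_components[OF P.is_ideal] lat_a_Q)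
qed

text \<open>The constant term of \<open>F\<close> is a power of \<open>x\<close> times a unit, so
  primality puts \<open>x\<close> itself into \<open>P\<close>. Together with
  \<open>nilradical\<close>, the element \<open>x\<close> generates the maximal ideal.\<close>

lemma maximal_id_subset_prime:
  assumes F: "F \<in> lat a" "enc F \<in> P" "F {} \<noteq> 0"
  shows "maximal_id \<subseteq> P"
proof
  define n where "n = nat (fls_subdegree (F {}))"
  have n: "int n = fls_subdegree (F {})"
    using lat_vge[OF F(1), of "{}"] F(3) by (auto simp: n_def a_empty vge_iff_subdegree)
  define u where "u = fls_X ^ n * inverse (F {})"
  have "vge 0 u" using F(3) n by (auto simp: u_def vge_iff_subdegree)
  then have "enc (mon {} u \<star> mon {} (F {})) \<in> P"
    by (intro ideal_conv[OF P.is_ideal] const_component[OF P.is_ideal nilradical_subset_prime F(1,2)])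
       (auto simp: empty_adm a_empty lat_closed)
  moreover have "u * F {} = fls_X ^ n" using F(3) by (simp add: u_def)
  ultimately have "enc (mon {} (fls_X ^ n)) \<in> P" by (simp add: mon_conv_mon empty_adm)
  moreover have B: "mon {} (fls_X ^ k) \<in> lat a" for k
    by (intro lat_closed) (auto simp: empty_adm a_empty vge_iff_subdegree)
  ultimately have "enc (mon {} fls_X) \<in> P"
  proof (induction n)
    case 0
    then have "P = carrier R" by (intro P.one_imp_carrier) simp
    with P.I_notcarr show ?case by simp
  next
    case (Suc n)
    have "enc (mon {} fls_X) \<otimes>\<^bsub>R\<^esub> enc (mon {} (fls_X ^ n)) \<in> P"
      using Suc.prems by (simp add: mon_conv_mon empty_adm)
    then show ?case using P.I_prime Suc B B[of 1] by auto
  qed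
  note XP = this
  fix x assume "x \<in> maximal_id"
  then obtain G where G: "G \<in> lat a" "vge 1 (G {})" "x = enc G" by (auto simp: maximal_id_def lat_max_order_iff)
  have "enc (mon {} (fls_shift 1 (G {})) \<star> mon {} fls_X) \<in> P"
    using G by (intro ideal_conv[OF P.is_ideal XP]) (auto simp: empty_adm a_empty lat_closed)
  moreover have "fls_shift 1 (G {}) * fls_X = G {}"
    by (simp add: fls_X_times_conv_shift)
  ultimately have *: "enc (mon {} (G {})) \<in> P" by (simp add: mon_conv_mon empty_adm)
  have "enc (mon S (G S)) \<in> P" if S: "S \<in> \<A>" for S
  proof (cases "S = {}")
    case False
    with S G have "enc (mon S (G S)) \<in> nilradical"
      using lat_closed(5)[OF S, of a "G S"] lat_vge[OF G(1)] by (subst nilradical_iff) (auto simp: mon_apply)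
    with nilradical_subset_prime show ?thesis ..
  qed (use * in auto)
  then show "x \<in> P" using G by (auto intro: ideal_components[OF P.is_ideal] lat_a_Q)
qed

lemma prime_cases: "P = nilradical \<or> P = maximal_id"
proof (cases "P \<subseteq> nilradical")
  case False
  then obtain x where x: "x \<in> P" "x \<notin> nilradical" by auto
  from ideal_elem[OF P.is_ideal x(1)] obtain F where F: "F \<in> lat a" "x = enc F" .
  then have "maximal_id \<subseteq> P" using x by (intro maximal_id_subset_prime) (auto simp: nilradical_iff lat_a_Q)
  then have "P = maximal_id \<or> P = carrier R"
    using maximalideal.I_maximal[OF maximal_id_maximal P.is_ideal] P.a_subset by blast
  with P.I_notcarr show ?thesis by auto
qed (use nilradical_subset_prime in auto)

end

lemma nilradical_psubset: "nilradical \<subset> maximal_id"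
proof -
  have "mon {} fls_X \<in> lat a" by (intro lat_closed) (auto simp: empty_adm a_empty vge_def)
  then have "enc (mon {} fls_X) \<in> maximal_id - nilradical"
    by (auto simp: maximal_id_iff nilradical_iff empty_adm vge_def mon_apply)
  moreover have "nilradical \<subseteq> maximal_id" by (auto simp: nilradical_def maximal_id_def lat_max_order_iff)
  ultimately show ?thesis by blast
qed

lemma maximal_iff: "maximalideal J R \<longleftrightarrow> J = maximal_id"
proof
  assume J: "maximalideal J R"
  then have "J = nilradical \<or> J = maximal_id" by (intro prime_cases R.maximalideal_prime)
  moreover have "J \<noteq> nilradical"
  proof
    assume "J = nilradical"
    then have "maximal_id = J \<or> maximal_id = carrier R"
      using J nilradical_psubset maximal_id_ideal ideal.Icarr[OF maximal_id_ideal]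
      by (intro maximalideal.I_maximal[OF J]) auto
    with \<open>J = nilradical\<close> nilradical_psubset maximalideal.I_notcarr[OF maximal_id_maximal] show False by auto
  qed
  ultimately show "J = maximal_id" by simp
qed (simp add: maximal_id_maximal)

lemma noetherian_local_R: "noetherian_local_ring R"
  by (auto simp: noetherian_local_ring_def R.is_cring noetherian_R maximal_iff)

lemma max_ideal_R: "max_ideal R = maximal_id"
  by (simp add: max_ideal_def maximal_iff)

lemma krull_dim_R: "krull_dim R = 1"
proof -
  let ?C = "\<lambda>n P. (\<forall>i\<le>n. primeideal (P i) R) \<and> (\<forall>i<n. P i \<subset> P (Suc i))"
  have "n \<le> 1" if C: "?C n P" for n P
  proof (rule ccontr)
    assume "\<not> n \<le> 1"
    then have "P 0 \<subset> P 1" "P 1 \<subset> P 2" "primeideal (P 0) R" "primeideal (P 1) R" "primeideal (P 2) R"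
      using C by (auto simp: numeral_2_eq_2)
    with prime_cases[of "P 0"] prime_cases[of "P 1"] prime_cases[of "P 2"] nilradical_psubset
    show False by auto
  qed
  then have le: "x \<le> enat 1" if "x \<in> {enat n | n. \<exists>P. ?C n P}" for x
  proof -
    from that obtain n P where "x = enat n" "?C n P" by blast
    with \<open>\<And>n P. ?C n P \<Longrightarrow> n \<le> 1\<close>[of n P] show ?thesis by simp
  qed
  have "\<exists>P. ?C 1 P"
    by (rule exI[of _ "\<lambda>i. if i = 0 then nilradical else maximal_id"])
       (use nilradical_prime R.maximalideal_prime[OF maximal_id_maximal] nilradical_psubset in auto)
  then have "enat 1 \<in> {enat n | n. \<exists>P. ?C n P}"
    by (intro CollectI exI[of _ "1::nat"] conjI refl)
  then have "enat 1 \<le> krull_dim R"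
    unfolding krull_dim_def by (rule Sup_upper)
  moreover have "krull_dim R \<le> enat 1"
    unfolding krull_dim_def using le by (rule Sup_least)
  ultimately show ?thesis
    unfolding one_enat_def by (rule antisym[rotated])
qed

section \<open>The injective resolution\<close>

definition cut_all :: "bool \<Rightarrow> (nat set \<Rightarrow> complex fls) \<Rightarrow> nat set \<Rightarrow> complex fls" where
  "cut_all b F = (\<lambda>S. cut b (a S) (F S))"

text \<open>One truncated family is chosen per class modulo the ring. Without cosets, the quotient
  keeps its carrier in the type of power series, as the definition of a resolution demands.\<close>

definition cut_Q :: "bool \<Rightarrow> (nat set \<Rightarrow> complex fls) set" where
  "cut_Q b = {F \<in> Q. cut_all b F = F}"

text \<open>\<open>E False\<close> is the total ring of fractions \<open>Q\<close>, and \<open>E True\<close> is its quotient by \<open>R\<close>.\<close>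

definition E :: "bool \<Rightarrow> (complex fps, complex fps) module" where
  "E b = \<lparr>carrier = enc ` cut_Q b, monoid.mult = undefined, monoid.one = undefined,
          ring.zero = 0, ring.add = (+), module.smult = (\<lambda>r u. enc (cut_all b (dec r \<star> dec u)))\<rparr>"

lemma cut_all_apply: "cut_all b F S = cut b (a S) (F S)"
  by (simp add: cut_all_def)

lemma cut_all_Q [simp]: "F \<in> Q \<Longrightarrow> cut_all b F \<in> Q"
  by (auto simp: Q_def cut_all_def)

lemma cut_all_idem [simp]: "cut_all b (cut_all b F) = cut_all b F"
  by (simp add: cut_all_def)

lemma cut_all_add: "cut_all b (\<lambda>S. F S + G S) = (\<lambda>S. cut_all b F S + cut_all b G S)"
  by (simp add: cut_all_def cut_add)

lemma cut_Q_Q: "F \<in> cut_Q b \<Longrightarrow> F \<in> Q" and cut_Q_Cut: "F \<in> cut_Q b \<Longrightarrow> cut_all b F = F"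
  and cut_all_cut_Q: "F \<in> Q \<Longrightarrow> cut_all b F \<in> cut_Q b"
  by (auto simp: cut_Q_def)

lemma cut_Q_closed:
  "(\<lambda>_. 0) \<in> cut_Q b" "F \<in> cut_Q b \<Longrightarrow> G \<in> cut_Q b \<Longrightarrow> (\<lambda>S. F S + G S) \<in> cut_Q b"
  "F \<in> cut_Q b \<Longrightarrow> (\<lambda>S. - F S) \<in> cut_Q b"
  unfolding cut_Q_def cut_all_def by (auto simp: cut_add cut_uminus fun_eq_iff)

lemma E_simps [simp]:
  "carrier (E b) = enc ` cut_Q b" "\<zero>\<^bsub>E b\<^esub> = 0" "x \<oplus>\<^bsub>E b\<^esub> y = x + y"
  "F \<in> Q \<Longrightarrow> G \<in> Q \<Longrightarrow> enc F \<odot>\<^bsub>E b\<^esub> enc G = enc (cut_all b (F \<star> G))"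
  by (auto simp: E_def)

text \<open>By \<open>a_union\<close> a ring element maps \<open>lat a\<close> into itself, so its
  product with a class does not depend on the representative.\<close>

lemma cut_all_conv:
  assumes F: "F \<in> lat a" and G: "G \<in> Q"
  shows "cut_all b (F \<star> cut_all b G) = cut_all b (F \<star> G)"
proof
  fix U
  have "cut b (a U) (F S * cut b (a (U - S)) (G (U - S))) = cut b (a U) (F S * G (U - S))"
    if U: "U \<in> \<A>" "S \<subseteq> U" for S
  proof (cases "S \<in> \<A> \<and> U - S \<in> \<A>")
    case True
    have "S \<union> (U - S) = U" using U by auto
    then have "a U \<le> a S + a (U - S)" using a_union[of S "U - S"] True U by auto
    with lat_vge[OF F] show ?thesis by (rule cut_mult_cut)
  next
    case False
    then have "F S = 0 \<or> G (U - S) = 0" using QD[OF lat_Q[OF F]] QD[OF G] by blast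
    then show ?thesis by auto
  qed
  then show "cut_all b (F \<star> cut_all b G) U = cut_all b (F \<star> G) U"
    by (auto simp: cut_all_def conv_def cut_sum intro!: sum.cong)
qed

lemma module_E: "module R (E b)"
proof (rule moduleI)
  show "abelian_group (E b)"
  proof (rule abelian_groupI)
    fix x assume "x \<in> carrier (E b)"
    then obtain F where F: "F \<in> cut_Q b" "x = enc F" by auto
    then have "enc (\<lambda>S. - F S) \<in> carrier (E b)" using cut_Q_closed by auto
    moreover have "enc (\<lambda>S. - F S) \<oplus>\<^bsub>E b\<^esub> x = \<zero>\<^bsub>E b\<^esub>" using F by (simp add: enc_add)
    ultimately show "\<exists>y\<in>carrier (E b). y \<oplus>\<^bsub>E b\<^esub> x = \<zero>\<^bsub>E b\<^esub>" by blast
  next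
    show "\<zero>\<^bsub>E b\<^esub> \<in> carrier (E b)" using cut_Q_closed(1) by (auto intro!: image_eqI[of _ _ "\<lambda>_. 0"])
  next
    fix x y assume "x \<in> carrier (E b)" "y \<in> carrier (E b)"
    then show "x \<oplus>\<^bsub>E b\<^esub> y \<in> carrier (E b)" by (auto simp: enc_add cut_Q_closed intro!: imageI)
  qed (auto simp: algebra_simps)
next
  fix r x assume "r \<in> carrier R" "x \<in> carrier (E b)"
  then show "r \<odot>\<^bsub>E b\<^esub> x \<in> carrier (E b)" by (auto simp: lat_Q cut_Q_Q cut_all_cut_Q)
next
  fix r s x assume "r \<in> carrier R" "s \<in> carrier R" "x \<in> carrier (E b)"
  then obtain F G H where *: "F \<in> lat a" "r = enc F" "G \<in> lat a" "s = enc G" "H \<in> cut_Q b" "x = enc H"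
    by auto
  then show "(r \<oplus>\<^bsub>R\<^esub> s) \<odot>\<^bsub>E b\<^esub> x = r \<odot>\<^bsub>E b\<^esub> x \<oplus>\<^bsub>E b\<^esub> s \<odot>\<^bsub>E b\<^esub> x"
    by (simp add: enc_add lat_Q cut_Q_Q conv_add_left cut_all_add)
  from * show "(r \<otimes>\<^bsub>R\<^esub> s) \<odot>\<^bsub>E b\<^esub> x = r \<odot>\<^bsub>E b\<^esub> (s \<odot>\<^bsub>E b\<^esub> x)"
    by (simp add: lat_Q cut_Q_Q conv_assoc cut_all_conv)
next
  fix r x y assume "r \<in> carrier R" "x \<in> carrier (E b)" "y \<in> carrier (E b)"
  then obtain F G H where *: "F \<in> lat a" "r = enc F" "G \<in> cut_Q b" "x = enc G" "H \<in> cut_Q b" "y = enc H"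
    by auto
  then show "r \<odot>\<^bsub>E b\<^esub> (x \<oplus>\<^bsub>E b\<^esub> y) = r \<odot>\<^bsub>E b\<^esub> x \<oplus>\<^bsub>E b\<^esub> r \<odot>\<^bsub>E b\<^esub> y"
    by (simp add: enc_add lat_Q cut_Q_Q conv_add_right cut_all_add)
next
  fix x assume "x \<in> carrier (E b)"
  then show "\<one>\<^bsub>R\<^esub> \<odot>\<^bsub>E b\<^esub> x = x"
    by (auto simp: cut_Q_Q cut_Q_Cut empty_adm mon_empty_conv)
qed (rule R.is_cring)

section \<open>Duality by the coefficient at the full set, and injectivity\<close>

definition dual_mon :: "nat set \<Rightarrow> nat set \<Rightarrow> complex fls" where
  "dual_mon S = mon (\<Omega> - S) (fls_shift (a S) 1)"

lemma shift_1_mult: "fls_shift m 1 * f = fls_shift m f" for f :: "'k::field fls"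
  using fls_X_intpow_times_conv_shift(1)[of "- m" f] by simp

lemma dual_mon_lat: "S \<in> \<A> \<Longrightarrow> dual_mon S \<in> lat a"
  unfolding dual_mon_def by (intro lat_closed adm_compl) (simp_all add: a_compl vge_def)

text \<open>Among the splittings of \<open>\<Omega>\<close> only the one with parts
  \<open>\<Omega> - S\<close> and \<open>S\<close> meets the support of \<open>dual_mon S\<close>.
  The coefficients at \<open>\<Omega>\<close> of these products therefore recover all coefficients
  of a truncated family.\<close>

lemma dual_mon_conv:
  assumes "S \<in> \<A>"
  shows "cut_all b (dual_mon S \<star> G) \<Omega> = fls_shift (a S) (cut_all b G S)"
proof -
  have "\<Omega> - (\<Omega> - S) = S" using adm_subset_Omega[OF assms] by auto
  then show ?thesis
    by (simp add: cut_all_apply dual_mon_def mon_conv Omega_adm a_Omega shift_1_mult cut_shift)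
qed

text \<open>Taking the coefficient at \<open>\<Omega>\<close> identifies linear maps over
  \<open>R\<close> into \<open>E b\<close> with functionals, linear over the power series, into the
  fraction field or its quotient. So \<open>f\<close> becomes a functional, which extends to
  \<open>B\<close>, and the extension is turned back into a linear map over
  \<open>R\<close>.\<close>

lemma injective_E: "injective_module R (E b)"
  unfolding injective_module_def
proof (intro conjI allI impI module_E, elim conjE)
  fix A B :: "(complex fps, complex fps) module" and i f
  assume i: "mod_hom R A B i" and inj: "inj_on i (carrier A)" and f: "mod_hom R A (E b) f"
  have A: "module R A" and B: "module R B" using i by (auto dest: mod_hom.axioms)
  interpret A: module R A by (rule A)
  interpret B: module R B by (rule B)
  interpret i: mod_hom R A B i by (rule i)
  interpret f: mod_hom R A "E b" f by (rule f)
  define j where "j = inv_into (carrier A) i"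
  have j: "j (i x) = x" if "x \<in> carrier A" for x
    unfolding j_def using inj that by (rule inv_into_f_f)
  \<comment> \<open>Restriction of scalars to the power series, which sit in \<open>R\<close> as the
    constants.\<close>
  define act where "act = (\<lambda>v y. enc (mon {} v) \<odot>\<^bsub>B\<^esub> y)"
  have iota: "mon {} v \<in> lat a" "enc (mon {} v) \<in> carrier R" if "vge 0 v" for v
    using that by (auto simp: lat_closed empty_adm a_empty)
  have iotaQ: "mon {} v \<in> Q" for v by (simp add: empty_adm)
  have fA: "\<exists>F\<in>cut_Q b. f x = enc F" if "x \<in> carrier A" for x
    using f.f_im[OF that] by auto
  have "\<exists>g. (\<forall>y\<in>carrier B. cut b 0 (g y) = g y) \<and>
    (\<forall>y\<in>carrier B. \<forall>z\<in>carrier B. g (y \<oplus>\<^bsub>B\<^esub> z) = g y + g z) \<and>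
    (\<forall>v. \<forall>y\<in>carrier B. vge 0 v \<longrightarrow> g (act v y) = cut b 0 (v * g y)) \<and>
    (\<forall>y\<in>i ` carrier A. g y = dec (f (j y)) \<Omega>)"
  proof (rule functional_extension[of B act "i ` carrier A" b "\<lambda>y. dec (f (j y)) \<Omega>"])
    show "abelian_group B" using B by (rule module.axioms)
    show "act v y \<in> carrier B" if "vge 0 v" "y \<in> carrier B" for v y
      using that iota by (simp add: act_def del: R_simps)
    show "act v (y \<oplus>\<^bsub>B\<^esub> z) = act v y \<oplus>\<^bsub>B\<^esub> act v z"
      if "vge 0 v" "y \<in> carrier B" "z \<in> carrier B" for v y z
      using that iota by (simp add: act_def B.smult_r_distr del: R_simps)
    show "act (v + w) y = act v y \<oplus>\<^bsub>B\<^esub> act w y" if "vge 0 v" "vge 0 w" "y \<in> carrier B" for v w y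
    proof -
      have "enc (mon {} (v + w)) = enc (mon {} v) \<oplus>\<^bsub>R\<^esub> enc (mon {} w)"
        by (auto simp: enc_add mon_apply intro!: arg_cong[of _ _ enc])
      with that iota show ?thesis by (simp add: act_def B.smult_l_distr del: R_simps)
    qed
    show "act (v * w) y = act v (act w y)" if "vge 0 v" "vge 0 w" "y \<in> carrier B" for v w y
    proof -
      have "enc (mon {} (v * w)) = enc (mon {} v) \<otimes>\<^bsub>R\<^esub> enc (mon {} w)"
        by (simp add: iotaQ mon_conv_mon empty_adm)
      with that iota show ?thesis by (simp add: act_def B.smult_assoc1 del: R_simps)
    qed
    show "act 1 y = y" if "y \<in> carrier B" for y
      using B.smult_one[OF that] by (simp add: act_def)
    show "act 0 y = \<zero>\<^bsub>B\<^esub>" if "y \<in> carrier B" for y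
      using B.smult_l_null[OF that] by (simp add: act_def)
    show "i ` carrier A \<subseteq> carrier B" by auto
    show "\<zero>\<^bsub>B\<^esub> \<in> i ` carrier A"
      using i.f0_is_0 A.zero_closed by (metis imageI)
    show "y \<oplus>\<^bsub>B\<^esub> z \<in> i ` carrier A" if "y \<in> i ` carrier A" "z \<in> i ` carrier A" for y z
      using that A.a_closed by (auto simp flip: i.f_add)
    show "act v y \<in> i ` carrier A" if "vge 0 v" "y \<in> i ` carrier A" for v y
      using that iota A.smult_closed by (auto simp: act_def simp flip: i.f_smult simp del: R_simps)
    show "cut b 0 (dec (f (j y)) \<Omega>) = dec (f (j y)) \<Omega>" if "y \<in> i ` carrier A" for y
    proof -
      from that obtain x where x: "x \<in> carrier A" "y = i x" by auto
      with fA obtain F where F: "F \<in> cut_Q b" "f x = enc F" by blast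
      have "cut b 0 (F \<Omega>) = F \<Omega>" using cut_Q_Cut[OF F(1)] by (metis cut_all_apply a_Omega)
      with x F show ?thesis by (simp add: j cut_Q_Q)
    qed
    show "dec (f (j (y \<oplus>\<^bsub>B\<^esub> z))) \<Omega> = dec (f (j y)) \<Omega> + dec (f (j z)) \<Omega>"
      if "y \<in> i ` carrier A" "z \<in> i ` carrier A" for y z
    proof -
      from that obtain x x' where x: "x \<in> carrier A" "y = i x" "x' \<in> carrier A" "z = i x'" by auto
      with fA obtain F F' where F: "F \<in> cut_Q b" "f x = enc F" "F' \<in> cut_Q b" "f x' = enc F'" by blast
      have "j (y \<oplus>\<^bsub>B\<^esub> z) = x \<oplus>\<^bsub>A\<^esub> x'" using x j[of "x \<oplus>\<^bsub>A\<^esub> x'"] by simp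
      then have "f (j (y \<oplus>\<^bsub>B\<^esub> z)) = enc (\<lambda>S. F S + F' S)"
        using x F by (simp add: enc_add)
      with x F show ?thesis by (simp add: j cut_Q_Q)
    qed
    show "dec (f (j (act v y))) \<Omega> = cut b 0 (v * dec (f (j y)) \<Omega>)"
      if "vge 0 v" "y \<in> i ` carrier A" for v y
    proof -
      from that obtain x where x: "x \<in> carrier A" "y = i x" by auto
      with fA obtain F where F: "F \<in> cut_Q b" "f x = enc F" by blast
      have v: "enc (mon {} v) \<in> carrier R" using that(1) by (rule iota)
      have "act v y = i (enc (mon {} v) \<odot>\<^bsub>A\<^esub> x)"
        using x v by (simp add: act_def del: R_simps)
      moreover have "enc (mon {} v) \<odot>\<^bsub>A\<^esub> x \<in> carrier A" using v x(1) by (rule A.smult_closed)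
      moreover have "f (enc (mon {} v) \<odot>\<^bsub>A\<^esub> x) = enc (cut_all b (mon {} v \<star> F))"
        using f.f_smult[OF v x(1)] F by (simp add: iotaQ cut_Q_Q)
      ultimately have "f (j (act v y)) = enc (cut_all b (mon {} v \<star> F))" by (simp add: j)
      then have "dec (f (j (act v y))) = cut_all b (mon {} v \<star> F)" by simp
      with x F show ?thesis
        by (simp add: j cut_Q_Q mon_empty_conv cut_all_apply a_Omega)
    qed
  qed
  then obtain g where g: "\<And>y. y \<in> carrier B \<Longrightarrow> cut b 0 (g y) = g y"
    "\<And>y z. y \<in> carrier B \<Longrightarrow> z \<in> carrier B \<Longrightarrow> g (y \<oplus>\<^bsub>B\<^esub> z) = g y + g z"
    "\<And>v y. vge 0 v \<Longrightarrow> y \<in> carrier B \<Longrightarrow> g (act v y) = cut b 0 (v * g y)"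
    "\<And>y. y \<in> i ` carrier A \<Longrightarrow> g y = dec (f (j y)) \<Omega>" by blast
  \<comment> \<open>The coefficients are forced by \<open>dual_mon_conv\<close>; the shift by
    \<open>- a S\<close> undoes the shift by \<open>a S\<close> there.\<close>
  define q where "q = (\<lambda>y S. if S \<in> \<A> then fls_shift (- a S) (g (enc (dual_mon S) \<odot>\<^bsub>B\<^esub> y)) else 0)"
  have dm: "enc (dual_mon S) \<in> carrier R" if "S \<in> \<A>" for S
    using dual_mon_lat[OF that] by auto
  have dm_closed: "enc (dual_mon S) \<odot>\<^bsub>B\<^esub> y \<in> carrier B" if "S \<in> \<A>" "y \<in> carrier B" for S y
    using dm[OF that(1)] that(2) by (rule B.smult_closed)
  have q_cut_Q: "q y \<in> cut_Q b" if "y \<in> carrier B" for y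
    using g(1)[OF dm_closed] that by (auto simp: cut_Q_def Q_def q_def cut_all_def fun_eq_iff cut_shift)
  \<comment> \<open>By construction this holds when \<open>F\<close> is some
    \<open>dual_mon S\<close>. Since \<open>g\<close> is linear over the power series it extends to
    all ring elements, and linearity of \<open>q\<close> over \<open>R\<close> follows from
    it.\<close>
  have key: "cut_all b (F \<star> q y) \<Omega> = g (enc F \<odot>\<^bsub>B\<^esub> y)" if F: "F \<in> lat a" and y: "y \<in> carrier B" for F y
  proof -
    have monR: "enc (mon S (F S)) \<in> carrier R" if "S \<in> \<A>" for S
      using lat_closed(5)[OF that, of a "F S"] lat_vge[OF F] by auto
    have comp: "cut b 0 (F S * q y (\<Omega> - S)) = g (enc (mon S (F S)) \<odot>\<^bsub>B\<^esub> y)" if S: "S \<in> \<A>" for S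
    proof -
      \<comment> \<open>The component of \<open>F\<close> at \<open>S\<close> is this power series
        times \<open>dual_mon (\<Omega> - S)\<close>.\<close>
      define v where "v = fls_shift (a S) (F S)"
      have v: "vge 0 v" using lat_vge[OF F] by (simp add: v_def)
      have S': "\<Omega> - S \<in> \<A>" "\<Omega> - (\<Omega> - S) = S"
        using adm_compl[OF S] adm_subset_Omega[OF S] by auto
      have "F S * q y (\<Omega> - S) = v * g (enc (dual_mon (\<Omega> - S)) \<odot>\<^bsub>B\<^esub> y)"
        using S S' by (simp add: q_def v_def a_compl fls_shifted_times_simps)
      then have "cut b 0 (F S * q y (\<Omega> - S)) = g (act v (enc (dual_mon (\<Omega> - S)) \<odot>\<^bsub>B\<^esub> y))"
        using g(3)[OF v dm_closed[OF S'(1) y]] by simp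
      also have "act v (enc (dual_mon (\<Omega> - S)) \<odot>\<^bsub>B\<^esub> y) = (enc (mon {} v) \<otimes>\<^bsub>R\<^esub> enc (dual_mon (\<Omega> - S))) \<odot>\<^bsub>B\<^esub> y"
        using iota(2)[OF v] dm[OF S'(1)] y by (simp add: act_def B.smult_assoc1 del: R_simps)
      also have "enc (mon {} v) \<otimes>\<^bsub>R\<^esub> enc (dual_mon (\<Omega> - S)) = enc (mon S (F S))"
      proof -
        have "v * fls_shift (- a S) 1 = F S"
          by (simp add: v_def shift_1_mult mult.commute[of _ "fls_shift _ 1"])
        then show ?thesis
          using S S' by (simp add: iotaQ dual_mon_def a_compl mon_conv_mon)
      qed
      finally show ?thesis .
    qed
    have partial: "(\<Sum>S\<in>Y. g (enc (mon S (F S)) \<odot>\<^bsub>B\<^esub> y)) = g (enc (\<lambda>T. \<Sum>S\<in>Y. mon S (F S) T) \<odot>\<^bsub>B\<^esub> y)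
        \<and> enc (\<lambda>T. \<Sum>S\<in>Y. mon S (F S) T) \<in> carrier R"
      if "Y \<subseteq> \<A>" for Y
      using finite_subset[OF that fin_adm] that
    proof (induction Y rule: finite_induct)
      case empty
      have "g (\<zero>\<^bsub>B\<^esub>) = 0" using g(2)[of "\<zero>\<^bsub>B\<^esub>" "\<zero>\<^bsub>B\<^esub>"] by simp
      moreover have "0 \<odot>\<^bsub>B\<^esub> y = \<zero>\<^bsub>B\<^esub>" using B.smult_l_null[OF y] by simp
      ultimately show ?case using R.zero_closed by simp
    next
      case (insert S Y)
      let ?s = "enc (\<lambda>T. \<Sum>S\<in>Y. mon S (F S) T)"
      have s: "?s \<in> carrier R" using insert by auto
      have eq: "enc (\<lambda>T. \<Sum>S\<in>insert S Y. mon S (F S) T) = enc (mon S (F S)) \<oplus>\<^bsub>R\<^esub> ?s"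
        using insert.hyps by (simp add: enc_add)
      have m: "enc (mon S (F S)) \<in> carrier R" using insert.prems by (intro monR) auto
      have "g (enc (\<lambda>T. \<Sum>S\<in>insert S Y. mon S (F S) T) \<odot>\<^bsub>B\<^esub> y)
          = g (enc (mon S (F S)) \<odot>\<^bsub>B\<^esub> y) + g (?s \<odot>\<^bsub>B\<^esub> y)"
        unfolding eq using m s y by (simp only: B.smult_l_distr g(2) B.smult_closed)
      then show ?case using insert R.a_closed[OF m s] eq by (simp del: R_simps)
    qed
    have "cut_all b (F \<star> q y) \<Omega> = (\<Sum>S\<in>Pow \<Omega>. cut b 0 (F S * q y (\<Omega> - S)))"
      by (simp add: cut_all_apply conv_def Omega_adm a_Omega cut_sum)
    also have "\<dots> = (\<Sum>S\<in>\<A>. cut b 0 (F S * q y (\<Omega> - S)))"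
      using adm_sub fin_Omega QD[OF lat_Q[OF F]] by (intro sum.mono_neutral_right) auto
    also have "\<dots> = (\<Sum>S\<in>\<A>. g (enc (mon S (F S)) \<odot>\<^bsub>B\<^esub> y))" using comp by simp
    also have "\<dots> = g (enc F \<odot>\<^bsub>B\<^esub> y)"
      using partial[of \<A>] mon_sum[OF lat_Q[OF F]] by simp
    finally show ?thesis .
  qed
  \<comment> \<open>Uniqueness half of the duality: an element of \<open>E b\<close> is determined
    by its pairings with the \<open>dual_mon S\<close>.\<close>
  have q_eqI: "q y = H" if "y \<in> carrier B" "H \<in> cut_Q b"
    "\<And>S. S \<in> \<A> \<Longrightarrow> g (enc (dual_mon S) \<odot>\<^bsub>B\<^esub> y) = cut_all b (dual_mon S \<star> H) \<Omega>" for y H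
    using that(3) QD[OF cut_Q_Q[OF that(2)]] cut_Q_Cut[OF that(2)]
    by (auto simp: q_def dual_mon_conv fun_eq_iff)
  show "\<exists>h. mod_hom R B (E b) h \<and> (\<forall>x\<in>carrier A. h (i x) = f x)"
  proof (intro exI[of _ "\<lambda>y. enc (q y)"] conjI ballI)
    show "mod_hom R B (E b) (\<lambda>y. enc (q y))"
    proof (intro mod_hom.intro mod_hom_axioms.intro B module_E)
      have "enc (q (y \<oplus>\<^bsub>B\<^esub> z)) = enc (q y) + enc (q z)" if "y \<in> carrier B" "z \<in> carrier B" for y z
      proof -
        have "q (y \<oplus>\<^bsub>B\<^esub> z) = (\<lambda>S. q y S + q z S)"
          using that dm dm_closed g(2) by (auto simp: q_def fun_eq_iff B.smult_r_distr simp del: R_simps)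
        then show ?thesis by (simp add: enc_add)
      qed
      moreover have "enc (q (r \<odot>\<^bsub>B\<^esub> y)) = r \<odot>\<^bsub>E b\<^esub> enc (q y)" if r: "r \<in> carrier R" and y: "y \<in> carrier B" for r y
      proof -
        from r obtain F where F: "F \<in> lat a" "r = enc F" by auto
        have "q (r \<odot>\<^bsub>B\<^esub> y) = cut_all b (F \<star> q y)"
        proof (rule q_eqI)
          fix S assume S: "S \<in> \<A>"
          have "enc (dual_mon S) \<odot>\<^bsub>B\<^esub> (r \<odot>\<^bsub>B\<^esub> y) = (enc (dual_mon S) \<otimes>\<^bsub>R\<^esub> r) \<odot>\<^bsub>B\<^esub> y"
            using dm[OF S] r y by (simp add: B.smult_assoc1 del: R_simps)
          also have "enc (dual_mon S) \<otimes>\<^bsub>R\<^esub> r = enc (dual_mon S \<star> F)"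
            using F dual_mon_lat[OF S] by (simp add: lat_a_Q)
          finally have "g (enc (dual_mon S) \<odot>\<^bsub>B\<^esub> (r \<odot>\<^bsub>B\<^esub> y)) = cut_all b (dual_mon S \<star> F \<star> q y) \<Omega>"
            using key[OF conv_lat_a[OF dual_mon_lat[OF S] F(1)] y] by simp
          also have "dual_mon S \<star> F \<star> q y = dual_mon S \<star> (F \<star> q y)"
            using dual_mon_lat[OF S] F cut_Q_Q[OF q_cut_Q[OF y]] by (intro conv_assoc) (auto simp: lat_a_Q)
          also have "cut_all b (dual_mon S \<star> (F \<star> q y)) = cut_all b (dual_mon S \<star> cut_all b (F \<star> q y))"
            using cut_all_conv[OF dual_mon_lat[OF S]] by simp
          finally show "g (enc (dual_mon S) \<odot>\<^bsub>B\<^esub> (r \<odot>\<^bsub>B\<^esub> y)) = cut_all b (dual_mon S \<star> cut_all b (F \<star> q y)) \<Omega>" .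
        qed (use r y in \<open>auto simp: cut_all_cut_Q simp del: R_simps intro: B.smult_closed\<close>)
        then show ?thesis using F cut_Q_Q[OF q_cut_Q[OF y]] by (simp add: lat_a_Q)
      qed
      ultimately show "(\<lambda>y. enc (q y)) \<in> module_hom R B (E b)"
        using q_cut_Q unfolding module_hom_def by (auto simp del: R_simps)
    qed
    fix x assume x: "x \<in> carrier A"
    with fA obtain F where F: "F \<in> cut_Q b" "f x = enc F" by blast
    have "q (i x) = F"
    proof (rule q_eqI)
      fix S assume S: "S \<in> \<A>"
      have "enc (dual_mon S) \<odot>\<^bsub>B\<^esub> i x = i (enc (dual_mon S) \<odot>\<^bsub>A\<^esub> x)"
        using dm[OF S] x by simp
      moreover have Ax: "enc (dual_mon S) \<odot>\<^bsub>A\<^esub> x \<in> carrier A" using dm[OF S] x by (rule A.smult_closed)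
      ultimately have "g (enc (dual_mon S) \<odot>\<^bsub>B\<^esub> i x) = dec (f (enc (dual_mon S) \<odot>\<^bsub>A\<^esub> x)) \<Omega>"
        using g(4) by (simp add: j)
      also have "f (enc (dual_mon S) \<odot>\<^bsub>A\<^esub> x) = enc (cut_all b (dual_mon S \<star> F))"
        using f.f_smult[OF dm[OF S] x] F dual_mon_lat[OF S] by (simp add: cut_Q_Q lat_a_Q)
      finally show "g (enc (dual_mon S) \<odot>\<^bsub>B\<^esub> i x) = cut_all b (dual_mon S \<star> F) \<Omega>" by simp
    qed (use x F in auto)
    then show "enc (q (i x)) = f x" using F by simp
  qed
qed

section \<open>The resolution of length one\<close>

definition zero_module :: "(complex fps, complex fps) module" where
  "zero_module = \<lparr>carrier = {0}, monoid.mult = undefined, monoid.one = undefined,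
        ring.zero = 0, ring.add = (+), module.smult = (\<lambda>_ _. 0)\<rparr>"

lemma module_zero_module: "module R zero_module"
  by (intro moduleI abelian_groupI R.is_cring) (auto simp: zero_module_def)

lemma injective_zero_module: "injective_module R zero_module"
proof -
  have "\<exists>g. mod_hom R B zero_module g \<and> (\<forall>x\<in>carrier A. g (i x) = f x)"
    if "mod_hom R A B i" "mod_hom R A zero_module f" for A B :: "(complex fps, complex fps) module" and i f
  proof -
    interpret f: mod_hom R A zero_module f by (rule that)
    have "module R B" using that(1) by (rule mod_hom.axioms)
    have "mod_hom R B zero_module (\<lambda>_. 0)"
      by (intro mod_hom.intro mod_hom_axioms.intro module_zero_module \<open>module R B\<close>)
         (auto simp: module_hom_def zero_module_def)
    moreover have "\<forall>x\<in>carrier A. 0 = f x" using f.f_im by (auto simp: zero_module_def)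
    ultimately show ?thesis by blast
  qed
  then show ?thesis unfolding injective_module_def using module_zero_module by blast
qed

lemma cut_Q_False [simp]: "cut_Q False = Q" and cut_all_False [simp]: "cut_all False F = F"
  by (auto simp: cut_Q_def cut_all_def cut_def)

lemma cut_all_True_eq_0_iff: "F \<in> Q \<Longrightarrow> cut_all True F = (\<lambda>_. 0) \<longleftrightarrow> F \<in> lat a"
  by (auto simp: cut_all_def fun_eq_iff cut_eq_0_iff lat_def QD)

lemma gorenstein_R: "gorenstein_local_ring R"
proof -
  define EE where "EE = (\<lambda>i::nat. if i = 0 then E False else if i = 1 then E True else zero_module)"
  \<comment> \<open>Truncation is the projection to the quotient by the ring; exactly the families
    in \<open>lat a\<close> truncate to zero.\<close>
  define d where "d = (\<lambda>i::nat. if i = 0 then (\<lambda>u. enc (cut_all True (dec u))) else (\<lambda>_. 0))"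
  have EE: "EE 0 = E False" "EE (Suc 0) = E True" "EE (Suc (Suc i)) = zero_module" for i
    by (auto simp: EE_def)
  have mod_EE: "module R (EE i)" for i
    by (simp add: EE_def module_E module_zero_module)
  have hom_d: "mod_hom R (EE i) (EE (Suc i)) (d i)" for i
  proof (intro mod_hom.intro mod_hom_axioms.intro mod_EE)
    consider "i = 0" | "i > 0" by auto
    then show "d i \<in> module_hom R (EE i) (EE (Suc i))"
    proof cases
      case 1
      then show ?thesis
        by (auto simp: module_hom_def d_def EE lat_a_Q cut_all_cut_Q enc_add cut_all_add cut_all_conv)
    next
      case 2
      then obtain j where i: "i = Suc j" by (cases i) auto
      then show ?thesis
        by (auto simp: module_hom_def d_def EE_def zero_module_def)
    qed
  qed
  have hom_id: "mod_hom R (regular_module R) (EE 0) (\<lambda>u. u)"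
    by (intro mod_hom.intro mod_hom_axioms.intro mod_EE module_regular_module R.is_cring)
       (auto simp: module_hom_def regular_module_def EE lat_a_Q)
  have "(\<lambda>u. u) ` carrier (regular_module R) = a_kernel (EE 0) (EE 1) (d 0)"
  proof -
    have "enc (cut_all True F) = 0 \<longleftrightarrow> F \<in> lat a" if "F \<in> Q" for F
      using that cut_all_True_eq_0_iff[OF that] enc_eq_iff[of "cut_all True F" "\<lambda>_. 0"] by simp
    then show ?thesis
      by (auto simp: a_kernel_def' regular_module_def EE d_def lat_a_Q)
  qed
  moreover have "d i ` carrier (EE i) = a_kernel (EE (Suc i)) (EE (Suc (Suc i))) (d (Suc i))" for i
  proof -
    have "carrier (E True) = (\<lambda>u. enc (cut_all True (dec u))) ` carrier (E False)"
    proof -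
      have "enc F = enc (cut_all True (dec (enc F)))" if "F \<in> cut_Q True" for F
        using that by (simp add: cut_Q_Q cut_Q_Cut)
      then show ?thesis by (auto simp: cut_all_cut_Q intro!: image_eqI dest: cut_Q_Q)
    qed
    moreover have "0 \<in> carrier (E b)" for b using cut_Q_closed(1) by (auto intro!: image_eqI[of _ _ "\<lambda>_. 0"])
    moreover from this have "(\<lambda>_. 0 :: complex fps) ` carrier (E b) = {0}" for b by blast
    moreover consider "i = 0" | "i = Suc 0" | j where "i = Suc (Suc j)" by (metis not0_implies_Suc)
    ultimately show ?thesis
      by cases (auto simp: a_kernel_def' EE_def d_def zero_module_def simp del: E_simps(1))
  qed
  moreover have "injective_module R (EE i)" for i
    by (simp add: EE_def injective_E injective_zero_module)
  ultimately have "injective_resolution R (regular_module R) EE (\<lambda>u. u) d"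
    unfolding injective_resolution_def using hom_id hom_d by (simp add: inj_on_def)
  moreover have "\<forall>i>1. carrier (EE i) = {\<zero>\<^bsub>EE i\<^esub>}"
    by (auto simp: EE_def zero_module_def)
  ultimately show ?thesis
    unfolding gorenstein_local_ring_def using noetherian_local_R by blast
qed

section \<open>Powers of the maximal ideal\<close>

text \<open>By \<open>cde\<close> all products respect the bound \<open>e\<close>. By
  \<open>split\<close> every index set \<open>U\<close> has a factorization reaching it, so each
  component of an element of \<open>lat e\<close> is itself a single product.\<close>

lemma ideal_prod_lat:
  assumes c: "ideal (enc ` lat c) R" and d: "ideal (enc ` lat d) R"
    and cde: "\<And>S T. \<lbrakk>S \<in> \<A>; T \<in> \<A>; S \<inter> T = {}; S \<union> T \<in> \<A>\<rbrakk> \<Longrightarrow> e (S \<union> T) \<le> c S + d T"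
    and split: "\<And>U. U \<in> \<A> \<Longrightarrow> \<exists>S\<in>\<A>. \<exists>T\<in>\<A>. S \<inter> T = {} \<and> S \<union> T = U \<and> c S + d T \<le> e U"
  shows "ideal_prod R (enc ` lat c) (enc ` lat d) = enc ` lat e"
proof (intro equalityI subsetI)
  fix x assume "x \<in> ideal_prod R (enc ` lat c) (enc ` lat d)"
  then show "x \<in> enc ` lat e"
  proof (induction rule: ideal_prod.induct)
    case (prod x y)
    then obtain F G where "F \<in> lat c" "x = enc F" "G \<in> lat d" "y = enc G" by auto
    moreover from this have "F \<star> G \<in> lat e" by (intro conv_lat[where c = c and d = d] cde)
    ultimately show ?case by (simp add: lat_Q)
  next
    case (sum x y)
    then show ?case using lat_closed(2) by (auto simp: enc_add)
  qed
next
  fix x assume "x \<in> enc ` lat e"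
  then obtain F where F: "F \<in> lat e" "x = enc F" by auto
  have "enc (mon U (F U)) \<in> ideal_prod R (enc ` lat c) (enc ` lat d)" if U: "U \<in> \<A>" for U
  proof -
    from split[OF U] obtain S T where ST: "S \<in> \<A>" "T \<in> \<A>" "S \<inter> T = {}" "S \<union> T = U" "c S + d T \<le> e U"
      by blast
    have "vge (c S + d T) (F U)" using vge_mono[OF lat_vge[OF F(1)] ST(5)] .
    \<comment> \<open>The factor \<open>x ^ c S\<close> goes to the monomial at \<open>S\<close>;
      what remains of \<open>F U\<close> has order at least \<open>d T\<close> and goes to
      \<open>T\<close>.\<close>
    then have "enc (mon S (fls_shift (- c S) 1)) \<otimes>\<^bsub>R\<^esub> enc (mon T (fls_shift (c S) (F U)))
        \<in> ideal_prod R (enc ` lat c) (enc ` lat d)"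
      using ST by (intro ideal_prod.prod imageI lat_closed) (auto simp: add.commute)
    then show ?thesis
      using ST U by (simp add: mon_conv_mon shift_1_mult)
  qed
  then have "enc F \<in> ideal_prod R (enc ` lat c) (enc ` lat d)"
    by (rule ideal_components[OF R.ideal_prod_is_ideal[OF c d] lat_Q[OF F(1)]])
  then show "x \<in> ideal_prod R (enc ` lat c) (enc ` lat d)" by (simp add: F(2))
qed

lemma ideal_power_lat:
  fixes c :: "nat \<Rightarrow> nat set \<Rightarrow> int"
  assumes c1: "\<And>S. S \<in> \<A> \<Longrightarrow> c 1 S = max_order S"
    and le: "\<And>j S T. \<lbrakk>1 \<le> j; j < n; S \<in> \<A>; T \<in> \<A>; S \<inter> T = {}; S \<union> T \<in> \<A>\<rbrakk>
      \<Longrightarrow> c (Suc j) (S \<union> T) \<le> c 1 S + c j T"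
    and split: "\<And>j U. \<lbrakk>1 \<le> j; j < n; U \<in> \<A>\<rbrakk>
      \<Longrightarrow> \<exists>S\<in>\<A>. \<exists>T\<in>\<A>. S \<inter> T = {} \<and> S \<union> T = U \<and> c 1 S + c j T \<le> c (Suc j) U"
    and j: "1 \<le> j" "j \<le> n"
  shows "ideal_power R (max_ideal R) j = enc ` lat (c j)"
proof -
  have id: "ideal (ideal_power R maximal_id j) R" for j
    by (rule R.ideal_power_ideal[OF maximal_id_ideal])
  have "lat (c 1) = lat max_order" using c1 by (auto simp: lat_def)
  then have maximal_id: "maximal_id = enc ` lat (c 1)" by (simp add: maximal_id_def)
  \<comment> \<open>By the recursion the first power is the maximal ideal times the whole ring, so
    it has to be computed as a product too, with the bound \<open>a\<close> for the second
    factor.\<close>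
  have one: "ideal_power R maximal_id 1 = maximal_id"
  proof -
    have "ideal_prod R (enc ` lat max_order) (enc ` lat a) = enc ` lat max_order"
    proof (rule ideal_prod_lat)
      show "ideal (enc ` lat max_order) R" using maximal_id_ideal by (simp add: maximal_id_def)
      show "ideal (enc ` lat a) R" using R.oneideal by simp
      fix S T assume "S \<in> \<A>" "T \<in> \<A>" "S \<inter> T = {}" "S \<union> T \<in> \<A>"
      then show "max_order (S \<union> T) \<le> max_order S + a T"
        using a_union[of S T] a_empty by (auto simp: max_order_def)
    next
      fix U assume "U \<in> \<A>"
      then show "\<exists>S\<in>\<A>. \<exists>T\<in>\<A>. S \<inter> T = {} \<and> S \<union> T = U \<and> max_order S + a T \<le> max_order U"
        by (intro bexI[of _ U] bexI[of _ "{}"]) (auto simp: a_empty empty_adm)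
    qed
    then show ?thesis by (simp add: maximal_id_def)
  qed
  have "ideal_power R maximal_id j = enc ` lat (c j)"
    using j
  proof (induction j rule: nat_induct_at_least)
    case base
    then show ?case using one maximal_id by simp
  next
    case (Suc j)
    then have IH: "ideal_power R maximal_id j = enc ` lat (c j)" by simp
    have "ideal_prod R (enc ` lat (c 1)) (enc ` lat (c j)) = enc ` lat (c (Suc j))"
    proof (rule ideal_prod_lat)
      show "ideal (enc ` lat (c 1)) R" using maximal_id_ideal maximal_id by simp
      show "ideal (enc ` lat (c j)) R" using id IH by metis
    qed (use le[of j] split[of j] Suc in auto)
    then show ?case using IH maximal_id by simp
  qed
  then show ?thesis by (simp add: max_ideal_R)
qed

section \<open>Hilbert function\<close>

text \<open>The graded piece splits over the index sets. At \<open>S\<close> it is zero if the two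
  bounds agree, and otherwise one-dimensional, the coordinate being the coefficient at order
  \<open>c S\<close>.\<close>

lemma hilbert_function_lat:
  assumes c: "ideal_power R (max_ideal R) h = enc ` lat c"
    and e: "ideal_power R (max_ideal R) (Suc h) = enc ` lat e"
    and ce: "\<And>S. S \<in> \<A> \<Longrightarrow> c S \<le> e S \<and> e S \<le> c S + 1"
  shows "hilbert_function R h = card {S \<in> \<A>. e S \<noteq> c S}"
proof -
  define K where "K = R Quot maximal_id"
  define V where "V = graded_piece R h"
  define N where "N = enc ` lat e"
  define D where "D = {S \<in> \<A>. e S \<noteq> c S}"
  have "vectorspace (R Quot maximal_id) (graded_piece R h)"
    using vectorspace_graded_piece[OF noetherian_local_R, of h] unfolding max_ideal_R .
  then interpret V: vectorspace K V unfolding K_def V_def .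
  interpret maximal_id: ideal maximal_id R by (rule maximal_id_ideal)
  have idp: "ideal (ideal_power R (max_ideal R) j) R" for j
    unfolding max_ideal_R by (rule R.ideal_power_ideal[OF maximal_id_ideal])
  have idN: "ideal N R" using idp[of "Suc h"] unfolding e N_def .
  have idL: "ideal (enc ` lat c) R" using idp[of h] unfolding c .
  interpret N: ideal N R by (rule idN)
  have lat_ca: "F \<in> lat a" if F: "F \<in> lat c" for F
  proof -
    have "enc F \<in> carrier R" using ideal.Icarr[OF idL, of "enc F"] F by blast
    then show ?thesis using F by (simp add: enc_mem_iff lat_Q)
  qed
  have e': "ideal_prod R (max_ideal R) (enc ` lat c) = N" using e c by (simp add: N_def)
  define co where "co = (\<lambda>F. N +>\<^bsub>R\<^esub> enc F)"
  have carr: "carrier V = co ` lat c"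
    by (simp add: V_def graded_piece_def Let_def c e' co_def image_image)
  have add: "co F \<oplus>\<^bsub>V\<^esub> co G = co (\<lambda>S. F S + G S)" if "F \<in> lat c" "G \<in> lat c" for F G
    using that N.a_rcos_sum[of "enc F" "enc G"] lat_ca
    by (simp add: V_def graded_piece_def Let_def c e' co_def enc_add)
  have zeroV: "\<zero>\<^bsub>V\<^esub> = N" by (simp add: V_def graded_piece_def Let_def c e')
  have co_eq: "co F = co G" if F: "F \<in> lat c" and G: "G \<in> lat c" and FG: "(\<lambda>S. F S - G S) \<in> lat e" for F G
  proof -
    have "enc (\<lambda>S. F S - G S) \<oplus>\<^bsub>R\<^esub> enc G \<in> N +>\<^bsub>R\<^esub> enc G"
      using FG unfolding a_r_coset_def' N_def by blast
    then have "enc F \<in> N +>\<^bsub>R\<^esub> enc G" by (simp add: enc_add)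
    then show ?thesis
      unfolding co_def using lat_ca[OF G] by (intro N.a_repr_independence'[symmetric]) auto
  qed
  have co_0: "co (\<lambda>_. 0) = \<zero>\<^bsub>V\<^esub>"
    using R.a_coset_add_zero[OF N.a_subset] by (simp add: co_def zeroV)
  \<comment> \<open>Complex constants represent each class of the residue field exactly
    once.\<close>
  define \<kappa> where "\<kappa> = (\<lambda>r. maximal_id +>\<^bsub>R\<^esub> enc (mon {} (fls_const r)))"
  have const: "mon {} (fls_const r) \<in> lat a" for r
    by (intro lat_closed) (auto simp: empty_adm a_empty)
  have K_carr: "\<exists>r. k = \<kappa> r" if "k \<in> carrier K" for k
  proof -
    from that obtain F where F: "F \<in> lat a" "k = maximal_id +>\<^bsub>R\<^esub> enc F"
      by (auto simp: K_def FactRing_def A_RCOSETS_def')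
    define r where "r = F {} $$ 0"
    have "vge 1 (F {} - fls_const r)"
      using lat_vge[OF F(1), of "{}"] by (auto simp: vge_def r_def a_empty)
    moreover have "(\<lambda>S. F S - mon {} (fls_const r) S) \<in> lat a"
      using F const lat_closed(3) by blast
    ultimately have "enc (\<lambda>S. F S - mon {} (fls_const r) S) \<in> maximal_id"
      using lat_a_Q by (subst maximal_id_iff) (auto simp: mon_apply)
    then have "enc (\<lambda>S. F S - mon {} (fls_const r) S) \<oplus>\<^bsub>R\<^esub> enc (mon {} (fls_const r)) \<in> maximal_id +>\<^bsub>R\<^esub> enc (mon {} (fls_const r))"
      unfolding a_r_coset_def' by blast
    then have "enc F \<in> maximal_id +>\<^bsub>R\<^esub> enc (mon {} (fls_const r))" by (simp add: enc_add)
    then have "maximal_id +>\<^bsub>R\<^esub> enc (mon {} (fls_const r)) = maximal_id +>\<^bsub>R\<^esub> enc F"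
      using const by (intro maximal_id.a_repr_independence') auto
    then show ?thesis using F by (auto simp: \<kappa>_def)
  qed
  have \<kappa>_carr: "\<kappa> r \<in> carrier K" for r
    using const by (auto simp: K_def FactRing_def A_RCOSETS_def' \<kappa>_def)
  have \<kappa>_0: "\<kappa> 0 = \<zero>\<^bsub>K\<^esub>"
    using R.a_coset_add_zero[OF maximal_id.a_subset] by (simp add: \<kappa>_def K_def FactRing_def)
  have inj_\<kappa>: "r = s" if "\<kappa> r = \<kappa> s" for r s
  proof -
    have "enc (mon {} (fls_const r)) \<in> maximal_id +>\<^bsub>R\<^esub> enc (mon {} (fls_const s))"
      using maximal_id.a_rcos_self[of "enc (mon {} (fls_const r))"] that const by (simp add: \<kappa>_def)
    then obtain u where u: "u \<in> maximal_id" "enc (mon {} (fls_const r)) = u + enc (mon {} (fls_const s))"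
      by (auto simp: a_r_coset_def')
    from ideal_elem[OF maximal_id_ideal u(1)] obtain F where F: "F \<in> lat a" "u = enc F" .
    have "vge 1 (F {})" using u(1) F by (simp add: maximal_id_iff lat_a_Q)
    moreover have "mon {} (fls_const r) = (\<lambda>S. F S + mon {} (fls_const s) S)"
      using u(2) F by (simp add: enc_add enc_eq_iff empty_adm lat_a_Q)
    then have "mon {} (fls_const r) {} = F {} + mon {} (fls_const s) {}" by metis
    then have "fls_const r = F {} + fls_const s" by (simp add: mon_apply)
    then have "fls_const r $$ 0 = F {} $$ 0 + fls_const s $$ 0" by simp
    ultimately show ?thesis by (simp add: vge_def)
  qed
  have scale: "\<kappa> r \<odot>\<^bsub>V\<^esub> co F = co (\<lambda>S. fls_const r * F S)" if F: "F \<in> lat c" for r F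
  proof -
    have "enc (mon {} (fls_const r)) \<in> carrier R" using const by auto
    moreover have "enc F \<in> ideal_power R (max_ideal R) h" using F c by auto
    ultimately have "(max_ideal R +>\<^bsub>R\<^esub> enc (mon {} (fls_const r))) \<odot>\<^bsub>graded_piece R h\<^esub>
        (ideal_power R (max_ideal R) (Suc h) +>\<^bsub>R\<^esub> enc F)
      = ideal_power R (max_ideal R) (Suc h) +>\<^bsub>R\<^esub> (enc (mon {} (fls_const r)) \<otimes>\<^bsub>R\<^esub> enc F)"
      by (rule graded_piece_smult[OF noetherian_local_R])
    then show ?thesis
      using F unfolding e N_def[symmetric] V_def[symmetric] \<kappa>_def co_def
      by (simp add: empty_adm lat_Q mon_empty_conv c e' max_ideal_R[symmetric])
  qed
  have scale_lat: "(\<lambda>S. fls_const r * F S) \<in> lat c" if F: "F \<in> lat c" for F r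
    using F vge_mult[of 0 "fls_const r"] by (auto simp: lat_def Q_def)
  define \<rho> where "\<rho> = (\<lambda>k. SOME r. k = \<kappa> r)"
  have \<rho>: "\<rho> (\<kappa> r) = r" for r
    unfolding \<rho>_def using inj_\<kappa> by (intro some_equality) auto
  \<comment> \<open>The choice of a representative does not matter for \<open>S\<close> in
    \<open>D\<close>: there \<open>e S = c S + 1\<close>, so elements of \<open>lat e\<close> have
    coefficient 0 at order \<open>c S\<close>.\<close>
  define \<psi> where "\<psi> = (\<lambda>S Y. dec (SOME u. u \<in> Y) S $$ c S)"
  have \<psi>: "\<psi> S (co F) = F S $$ c S" if S: "S \<in> D" and F: "F \<in> lat c" for S F
  proof -
    have "enc F \<in> co F" unfolding co_def using lat_ca[OF F] by (intro N.a_rcos_self) auto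
    then have "(SOME u. u \<in> co F) \<in> co F" by (rule someI)
    then obtain G where G: "G \<in> lat e" "(SOME u. u \<in> co F) = enc G + enc F"
      by (auto simp: co_def a_r_coset_def' N_def)
    have "vge (c S + 1) (G S)"
      using lat_vge[OF G(1), of S] ce[of S] S by (auto simp: D_def intro: vge_mono)
    then show ?thesis
      using G F by (simp add: \<psi>_def enc_add lat_Q vge_def)
  qed
  define b where "b = (\<lambda>S. mon S (fls_shift (- c S) (1 :: complex fls)))"
  have b: "b S \<in> lat c" if "S \<in> D" for S
    using that by (auto simp: b_def D_def intro: lat_closed)
  have span: "carrier V \<subseteq> V.span ((\<lambda>S. co (b S)) ` D)"
  proof
    fix x assume "x \<in> carrier V"
    then obtain F where F: "F \<in> lat c" "x = co F" by (auto simp: carr)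
    have sub: "(\<lambda>S. co (b S)) ` D \<subseteq> carrier V" using b by (auto simp: carr)
    interpret s: submodule K "V.span ((\<lambda>S. co (b S)) ` D)" V
      by (rule V.span_is_submodule[OF sub])
    have mon: "mon S (F S) \<in> lat c" if "S \<in> \<A>" for S
      using lat_vge[OF F(1)] that by (intro lat_closed)
    have comp: "co (mon S (F S)) \<in> V.span ((\<lambda>S. co (b S)) ` D)" if S: "S \<in> \<A>" for S
    proof (cases "S \<in> D")
      case True
      define r where "r = F S $$ c S"
      have "\<kappa> r \<odot>\<^bsub>V\<^esub> co (b S) \<in> V.span ((\<lambda>S. co (b S)) ` D)"
        using True V.in_own_span[OF sub] \<kappa>_carr by (intro s.smult_closed) auto
      moreover have "co (\<lambda>T. fls_const r * b S T) = co (mon S (F S))"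
      proof (rule co_eq)
        have "e S = c S + 1" using ce[OF S] True by (auto simp: D_def)
        then have "vge (e S) (fls_const r * fls_shift (- c S) 1 - F S)"
          using lat_vge[OF F(1), of S] by (auto simp: vge_def r_def)
        then have "mon S (fls_const r * fls_shift (- c S) 1 - F S) \<in> lat e"
          using S by (intro lat_closed)
        moreover have "(\<lambda>T. fls_const r * b S T - mon S (F S) T) = mon S (fls_const r * fls_shift (- c S) 1 - F S)"
          by (auto simp: b_def mon_apply)
        ultimately show "(\<lambda>T. fls_const r * b S T - mon S (F S) T) \<in> lat e" by simp
      qed (use scale_lat b True mon S in auto)
      ultimately show ?thesis using scale[OF b[OF True]] by simp
    next
      case False
      then have "e S = c S" using S by (simp add: D_def)
      then have "mon S (F S) \<in> lat e" using S lat_vge[OF F(1), of S] by (intro lat_closed) auto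
      then have "co (mon S (F S)) = \<zero>\<^bsub>V\<^esub>"
        using co_eq[OF mon[OF S], of "\<lambda>_. 0"] co_0 lat_closed(1) by simp
      then show ?thesis using s.zero_closed by simp
    qed
    have "co (\<lambda>T. \<Sum>S\<in>Y. mon S (F S) T) \<in> V.span ((\<lambda>S. co (b S)) ` D) \<and> (\<lambda>T. \<Sum>S\<in>Y. mon S (F S) T) \<in> lat c"
      if "Y \<subseteq> \<A>" for Y
      using finite_subset[OF that fin_adm] that
    proof (induction Y rule: finite_induct)
      case empty
      then show ?case using co_0 s.zero_closed lat_closed(1) by simp
    next
      case (insert S Y)
      then have S: "S \<in> \<A>" and Y: "co (\<lambda>T. \<Sum>S\<in>Y. mon S (F S) T) \<in> V.span ((\<lambda>S. co (b S)) ` D)"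
        "(\<lambda>T. \<Sum>S\<in>Y. mon S (F S) T) \<in> lat c" by auto
      have eq: "(\<lambda>T. \<Sum>S\<in>insert S Y. mon S (F S) T) = (\<lambda>T. mon S (F S) T + (\<Sum>S\<in>Y. mon S (F S) T))"
        using insert.hyps by simp
      show ?case
        unfolding eq using add[OF mon[OF S] Y(2)] s.m_closed[OF comp[OF S] Y(1)]
          lat_closed(2)[OF mon[OF S] Y(2)] by simp
    qed
    from this[of \<A>] show "x \<in> V.span ((\<lambda>S. co (b S)) ` D)"
      using F by (simp add: mon_sum[OF lat_Q[OF F(1)]])
  qed
  have "V.dim = card D"
  proof (rule V.dim_coordinates[where \<rho> = \<rho> and \<psi> = \<psi> and b = "\<lambda>S. co (b S)"])
    show "finite D" using fin_adm by (simp add: D_def)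
    show "co (b S) \<in> carrier V" if "S \<in> D" for S using b[OF that] by (auto simp: carr)
    show "\<psi> S (x \<oplus>\<^bsub>V\<^esub> y) = \<psi> S x + \<psi> S y" if "S \<in> D" "x \<in> carrier V" "y \<in> carrier V" for S x y
    proof -
      from that obtain F G where *: "F \<in> lat c" "x = co F" "G \<in> lat c" "y = co G" by (auto simp: carr)
      with lat_closed(2)[of F c G] that(1) show ?thesis by (simp add: add \<psi>)
    qed
    show "\<psi> S (k \<odot>\<^bsub>V\<^esub> x) = \<rho> k * \<psi> S x" if "S \<in> D" "k \<in> carrier K" "x \<in> carrier V" for S k x
    proof -
      from that obtain F where *: "F \<in> lat c" "x = co F" by (auto simp: carr)
      obtain r where "k = \<kappa> r" using K_carr[OF \<open>k \<in> carrier K\<close>] by blast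
      with * scale_lat[of F r] that(1) show ?thesis by (simp add: scale \<psi> \<rho>)
    qed
    show "k = \<zero>\<^bsub>K\<^esub>" if "k \<in> carrier K" "\<rho> k = 0" for k
    proof -
      obtain r where "k = \<kappa> r" using K_carr[OF \<open>k \<in> carrier K\<close>] by blast
      with \<open>\<rho> k = 0\<close> \<kappa>_0 show ?thesis by (simp only: \<rho>)
    qed
    show "\<psi> S (co (b T)) = (if S = T then 1 else 0)" if "S \<in> D" "T \<in> D" for S T
      using \<psi>[OF that(1) b[OF that(2)]] by (auto simp: b_def mon_apply)
    show "carrier V \<subseteq> V.span ((\<lambda>S. co (b S)) ` D)" by (rule span)
  qed
  then show ?thesis
    by (simp add: hilbert_function_def max_ideal_R K_def V_def D_def)
qed

section \<open>Nilpotent elements\<close>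

lemma mon_self [simp]: "mon S f S = f"
  by (simp add: mon_apply)

lemma pow_empty:
  assumes F: "F \<in> lat a"
  shows "\<exists>G\<in>lat a. enc F [^]\<^bsub>R\<^esub> n = enc G \<and> G {} = F {} ^ n"
proof (induction n)
  case 0
  show ?case using one_lat by (intro bexI[of _ "mon {} 1"]) auto
next
  case (Suc n)
  then obtain G where G: "G \<in> lat a" "enc F [^]\<^bsub>R\<^esub> n = enc G" "G {} = F {} ^ n" by blast
  with F show ?case
    by (intro bexI[of _ "G \<star> F"]) (auto simp: conv_empty lat_a_Q conv_lat_a)
qed

text \<open>Without a constant term, each further factor enlarges the index set by at least one
  element.\<close>

lemma pow_support:
  assumes F: "F \<in> lat a" "F {} = 0"
  shows "\<exists>G\<in>lat a. enc F [^]\<^bsub>R\<^esub> n = enc G \<and> (\<forall>S. card S < n \<longrightarrow> G S = 0)"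
proof (induction n)
  case 0
  show ?case using one_lat by (intro bexI[of _ "mon {} 1"]) auto
next
  case (Suc n)
  then obtain G where G: "G \<in> lat a" "enc F [^]\<^bsub>R\<^esub> n = enc G" "\<And>S. card S < n \<Longrightarrow> G S = 0" by blast
  have "(G \<star> F) U = 0" if U: "card U < Suc n" for U
  proof (cases "U \<in> \<A>")
    case True
    have "G S * F (U - S) = 0" if S: "S \<subseteq> U" for S
    proof (cases "S = U")
      case False
      then have "card S < card U" using S finite_mem_adm[OF True] by (intro psubset_card_mono) auto
      then show ?thesis using U G(3) by simp
    qed (simp add: F(2))
    then show ?thesis by (auto simp: conv_def intro: sum.neutral)
  qed (simp add: conv_def)
  with F(1) G(1,2) show ?case
    by (intro bexI[of _ "G \<star> F"]) (auto simp: lat_a_Q conv_lat_a)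
qed

lemma nilpotent_pow_eq_0:
  assumes F: "F \<in> lat a" "F {} = 0" and n: "card \<Omega> < n"
  shows "enc F [^]\<^bsub>R\<^esub> n = 0"
proof -
  obtain G where G: "G \<in> lat a" "enc F [^]\<^bsub>R\<^esub> n = enc G" "\<And>S. card S < n \<Longrightarrow> G S = 0"
    using pow_support[OF F] by blast
  have "G S = 0" for S
  proof (cases "S \<in> \<A>")
    case True
    then have "card S \<le> card \<Omega>" using adm_subset_Omega fin_Omega by (intro card_mono)
    then show ?thesis using G(3) n by simp
  qed (use G(1) lat_a_Q QD in auto)
  then have "G = (\<lambda>_. 0)" by auto
  then show ?thesis using G(2) by simp
qed

text \<open>The constant term is multiplicative with values in a field, so it vanishes for nilpotent
  elements. Then a power beyond \<open>card \<Omega>\<close> has no index set left.\<close>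

lemma nilpotency_le:
  assumes "nilpotency R n"
  shows "n \<le> card \<Omega>"
proof -
  from assms obtain F k where F: "F \<in> lat a" "enc F [^]\<^bsub>R\<^esub> n \<noteq> 0" "enc F [^]\<^bsub>R\<^esub> (k::nat) = 0"
    by (auto simp: nilpotency_def)
  obtain G where G: "G \<in> lat a" "enc G = 0" "G {} = F {} ^ k"
    using pow_empty[OF F(1), of k] F(3) by auto
  have "G = (\<lambda>_. 0)" using G enc_eq_iff[of G "\<lambda>_. 0"] by (simp add: lat_a_Q)
  then have "F {} ^ k = 0" using G(3) by metis
  then have "F {} = 0" by simp
  then show ?thesis using nilpotent_pow_eq_0[OF F(1), of n] F(2) by (meson not_le)
qed

text \<open>The witness is the sum of the variables in \<open>T\<close>. Its power
  \<open>card T\<close> has coefficient \<open>fact (card T)\<close> at \<open>T\<close>, which is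
  nonzero in characteristic zero.\<close>

lemma nilpotency_ge:
  assumes T: "finite T" "\<And>S. S \<subseteq> T \<Longrightarrow> S \<in> \<A>" and aT: "\<And>i. i \<in> T \<Longrightarrow> a {i} \<le> 0"
  shows "nilpotency R (card T)"
proof -
  define F :: "nat set \<Rightarrow> complex fls" where "F = (\<lambda>S. if S \<in> (\<lambda>i. {i}) ` T then 1 else 0)"
  have F: "F \<in> lat a"
    using T(2) aT by (intro latI QI) (auto simp: F_def intro: vge_mono[OF vge_1])
  have F0: "F {} = 0" by (auto simp: F_def)
  have "\<exists>G\<in>lat a. enc F [^]\<^bsub>R\<^esub> n = enc G \<and> (\<forall>S\<subseteq>T. card S = n \<longrightarrow> G S = fact n)" for n
  proof (induction n)
    case 0
    have "mon {} 1 S = fact 0" if "S \<subseteq> T" "card S = 0" for S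
      using that finite_subset[OF that(1) T(1)] by simp
    then show ?case using one_lat by (intro bexI[of _ "mon {} 1"] conjI) (simp_all del: fact_0)
  next
    case (Suc n)
    then obtain G where G: "G \<in> lat a" "enc F [^]\<^bsub>R\<^esub> n = enc G" "\<And>S. S \<subseteq> T \<Longrightarrow> card S = n \<Longrightarrow> G S = fact n"
      by blast
    have "(G \<star> F) S = fact (Suc n)" if S: "S \<subseteq> T" "card S = Suc n" for S
    proof -
      have fin: "finite S" using S(1) T(1) by (rule finite_subset)
      have "(G \<star> F) S = (\<Sum>U\<in>Pow S. G U * F (S - U))" using T(2)[OF S(1)] by (simp add: conv_def)
      also have "\<dots> = (\<Sum>U\<in>(\<lambda>i. S - {i}) ` S. G U * F (S - U))"
      proof (rule sum.mono_neutral_right)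
        show "\<forall>U\<in>Pow S - (\<lambda>i. S - {i}) ` S. G U * F (S - U) = 0"
        proof
          fix U assume U: "U \<in> Pow S - (\<lambda>i. S - {i}) ` S"
          have "S - U \<noteq> {i}" for i
          proof
            assume "S - U = {i}"
            then have "U = S - {i}" "i \<in> S" using U by auto
            with U show False by blast
          qed
          then show "G U * F (S - U) = 0" by (auto simp: F_def)
        qed
      qed (use fin in auto)
      also have "\<dots> = (\<Sum>i\<in>S. G (S - {i}) * F (S - (S - {i})))"
        by (rule sum.reindex[unfolded o_def]) (auto intro!: inj_onI)
      also have "\<dots> = (\<Sum>i\<in>S. fact n)"
      proof (rule sum.cong)
        fix i assume i: "i \<in> S"
        then have "S - (S - {i}) = {i}" by auto
        moreover have "card (S - {i}) = n" using i S(2) fin by simp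
        ultimately show "G (S - {i}) * F (S - (S - {i})) = fact n"
          using G(3)[of "S - {i}"] i S(1) by (auto simp: F_def)
      qed simp
      also have "\<dots> = fact (Suc n)" using S(2) by simp
      finally show ?thesis .
    qed
    with F G(1,2) show ?case
      by (intro bexI[of _ "G \<star> F"]) (auto simp: lat_a_Q conv_lat_a)
  qed
  then obtain G where G: "G \<in> lat a" "enc F [^]\<^bsub>R\<^esub> card T = enc G" "\<forall>S\<subseteq>T. card S = card T \<longrightarrow> G S = fact (card T)"
    by blast
  then have "G T \<noteq> 0" by simp
  then have "enc G \<noteq> 0" using enc_eq_iff[of G "\<lambda>_. 0"] G(1) by (auto simp: lat_a_Q)
  moreover have "enc F [^]\<^bsub>R\<^esub> Suc (card \<Omega>) = 0" using F F0 by (rule nilpotent_pow_eq_0) simp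
  ultimately show ?thesis
    unfolding nilpotency_def using F G(2) by (intro bexI[of _ "enc F"] conjI exI[of _ "Suc (card \<Omega>)"]) auto
qed

end

section \<open>The rings\<close>

text \<open>Here \<open>s\<close>, \<open>t\<close>, \<open>u\<close> are the degrees of two factors
  and of their product; the three parts are a product of monomials, a dual times a monomial, and a
  monomial times a dual. A tight case is an element of degree \<open>N\<close> against its own dual:
  the product has \<open>u = 0\<close>, and \<open>j \<le> h < N\<close> makes the left side
  vanish.\<close>

lemma pow_order_union_arith:
  fixes h N j s t u :: nat
  assumes "1 \<le> j" "j \<le> h" "2 \<le> h" "h < N"
  shows "u = s + t \<Longrightarrow> u \<le> N \<Longrightarrow>
      (if u = N then min 0 (int (Suc j) - int h) else max 0 (int (Suc j) - int u))
      \<le> (if s = N then min 0 (int 1 - int h) else max 0 (int 1 - int s))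
        + (if t = N then min 0 (int j - int h) else max 0 (int j - int t))"
    and "u + t = s \<Longrightarrow> s \<le> N \<Longrightarrow>
      (if u = N then int (Suc j) + int h - 2 else max 0 (int (Suc j) - int N + int u))
      \<le> (if s = N then int 1 + int h - 2 else max 0 (int 1 - int N + int s))
        + (if t = N then min 0 (int j - int h) else max 0 (int j - int t))"
    and "u + s = t \<Longrightarrow> t \<le> N \<Longrightarrow>
      (if u = N then int (Suc j) + int h - 2 else max 0 (int (Suc j) - int N + int u))
      \<le> (if s = N then min 0 (int 1 - int h) else max 0 (int 1 - int s))
        + (if t = N then int j + int h - 2 else max 0 (int j - int N + int t))"
  using assms by (auto simp: max_def min_def)

text \<open>The subsets \<open>S\<close> not containing \<open>0\<close> index the squarefree monomials of degree at most \<open>N\<close> in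
  \<open>r\<close> variables, those containing \<open>0\<close> the elements dual to the complementary monomials.
  The monomials of degree \<open>N\<close> are divided by the power \<open>h - 1\<close> of the uniformizer.\<close>

locale drop_datum =
  fixes h N r :: nat
  assumes h: "2 \<le> h" "h < N" and r: "4 * N \<le> r"
begin

text \<open>The degree of the monomial at \<open>S\<close>, or of the monomial to which the element
  at \<open>S\<close> is dual.\<close>

definition sz :: "nat set \<Rightarrow> nat" where
  "sz S = card (if 0 \<in> S then {0..r} - S else S)"

definition adm :: "nat set set" where
  "adm = {S. S \<subseteq> {0..r} \<and> sz S \<le> N}"

definition order :: "nat set \<Rightarrow> int" where
  "order S = (if sz S = N then if 0 \<in> S then int h - 1 else 1 - int h else 0)"

text \<open>The coefficients of the power \<open>j\<close> of the maximal ideal are those of order at least \<open>pow_order j S\<close>,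
  provided that \<open>1 \<le> j \<le> h + 1\<close>.\<close>

definition pow_order :: "nat \<Rightarrow> nat set \<Rightarrow> int" where
  "pow_order j S = (if 0 \<in> S then if sz S = N then int j + int h - 2 else max 0 (int j - int N + int (sz S))
     else if sz S = N then min 0 (int j - int h) else max 0 (int j - int (sz S)))"

section \<open>Degrees in the idealization\<close>

lemma sz_compl: "S \<subseteq> {0..r} \<Longrightarrow> sz ({0..r} - S) = sz S"
  by (auto simp: sz_def double_diff)

text \<open>Degrees of monomials add, whereas a monomial times a dual is the dual of a quotient, so
  that degrees subtract. Two duals share the index \<open>0\<close> and are never disjoint.\<close>

lemma sz_union:
  assumes "S \<subseteq> {0..r}" "T \<subseteq> {0..r}" "S \<inter> T = {}"
  shows "0 \<notin> S \<Longrightarrow> 0 \<notin> T \<Longrightarrow> sz (S \<union> T) = sz S + sz T"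
    and "0 \<in> S \<Longrightarrow> sz (S \<union> T) + sz T = sz S" and "0 \<in> T \<Longrightarrow> sz (S \<union> T) + sz S = sz T"
proof -
  have fin: "finite S" "finite T" using assms(1,2) by (auto intro: finite_subset)
  then show "0 \<notin> S \<Longrightarrow> 0 \<notin> T \<Longrightarrow> sz (S \<union> T) = sz S + sz T"
    using assms(3) by (simp add: sz_def card_Un_disjoint)
  show "sz (S \<union> T) + sz T = sz S" if "0 \<in> S"
  proof -
    have "card ({0..r} - S - T) + card T = card ({0..r} - S)"
      using assms fin by (subst card_Diff_subset) (auto intro!: le_add_diff_inverse2 card_mono)
    moreover have "0 \<notin> T" using that assms(3) by auto
    ultimately show ?thesis using that by (simp add: sz_def set_diff_eq Un_def Collect_conj_eq conj_assoc)
  qed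
  show "sz (S \<union> T) + sz S = sz T" if "0 \<in> T"
  proof -
    have "card ({0..r} - T - S) + card S = card ({0..r} - T)"
      using assms fin by (subst card_Diff_subset) (auto intro!: le_add_diff_inverse2 card_mono)
    moreover have "0 \<notin> S" using that assms(3) by auto
    moreover have "{0..r} - (S \<union> T) = {0..r} - T - S" by auto
    ultimately show ?thesis using that by (simp add: sz_def)
  qed
qed

lemma sz_eq_0_iff: "S \<subseteq> {0..r} \<Longrightarrow> 0 \<notin> S \<Longrightarrow> sz S = 0 \<longleftrightarrow> S = {}"
  by (auto simp: sz_def dest: finite_subset)

sublocale monomial_datum "{0..r}" adm order
proof
  show "adm \<subseteq> Pow {0..r}" by (auto simp: adm_def)
  show "{} \<in> adm" "order {} = 0" using h by (auto simp: adm_def order_def sz_def)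
  show "{0..r} - S \<in> adm" if "S \<in> adm" for S using that sz_compl[of S] by (auto simp: adm_def)
  show "order ({0..r} - S) = - order S" if "S \<in> adm" for S
    using that sz_compl[of S] by (auto simp: adm_def order_def)
next
  fix S T U assume *: "S \<in> adm" "T \<in> adm" "U \<in> adm" "S \<inter> T = {}" "(S \<union> T) \<inter> U = {}" "S \<union> T \<union> U \<in> adm"
  then have sub: "S \<subseteq> {0..r}" "T \<subseteq> {0..r}" "U \<subseteq> {0..r}" "S \<union> T \<subseteq> {0..r}"
    and le: "sz S \<le> N" "sz T \<le> N" "sz U \<le> N" "sz (S \<union> T \<union> U) \<le> N"
    by (auto simp: adm_def)
  have "sz (S \<union> T) \<le> N"
    using sz_union[OF sub(1,2) *(4)] sz_union[OF sub(4,3) *(5)] le by (cases "0 \<in> S"; cases "0 \<in> T"; cases "0 \<in> U") auto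
  with sub show "S \<union> T \<in> adm" by (simp add: adm_def)
next
  fix S T assume *: "S \<in> adm" "T \<in> adm" "S \<inter> T = {}" "S \<union> T \<in> adm"
  then have sub: "S \<subseteq> {0..r}" "T \<subseteq> {0..r}" and le: "sz S \<le> N" "sz T \<le> N" "sz (S \<union> T) \<le> N"
    by (auto simp: adm_def)
  show "order (S \<union> T) \<le> order S + order T"
    using sz_union[OF sub *(3)] sz_eq_0_iff[OF sub(1)] sz_eq_0_iff[OF sub(2)] le h *(3)
    by (cases "0 \<in> S"; cases "0 \<in> T") (auto simp: order_def)
qed simp_all

section \<open>Powers of the maximal ideal in the idealization\<close>

lemma pow_order_1:
  assumes S: "S \<in> adm"
  shows "pow_order 1 S = max_order S"
proof (cases "S = {}")
  case True
  then show ?thesis using h by (simp add: pow_order_def max_order_def sz_def)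
next
  case False
  then have "sz S \<noteq> 0 \<or> 0 \<in> S" "sz S \<le> N" using sz_eq_0_iff[of S] S by (auto simp: adm_def)
  moreover have "max_order S = order S" using False by (simp add: max_order_def)
  ultimately show ?thesis using h unfolding pow_order_def order_def by (cases "sz S = N"; cases "0 \<in> S") simp_all
qed

lemma pow_order_union:
  assumes j: "1 \<le> j" "j < Suc h" and *: "S \<in> adm" "T \<in> adm" "S \<inter> T = {}" "S \<union> T \<in> adm"
  shows "pow_order (Suc j) (S \<union> T) \<le> pow_order 1 S + pow_order j T"
proof -
  have sub: "S \<subseteq> {0..r}" "T \<subseteq> {0..r}" and le: "sz S \<le> N" "sz T \<le> N" "sz (S \<union> T) \<le> N"
    using * by (auto simp: adm_def)
  obtain s t u where stu: "sz S = s" "sz T = t" "sz (S \<union> T) = u" by blast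
  note un = sz_union[OF sub *(3), unfolded stu] and le' = le[unfolded stu]
  consider "0 \<notin> S" "0 \<notin> T" | "0 \<in> S" "0 \<notin> T" | "0 \<notin> S" "0 \<in> T" using *(3) by auto
  then show ?thesis
  proof cases
    case 1
    then have "u = s + t" using un(1) by simp
    then show ?thesis
      using pow_order_union_arith(1)[where j = j and h = h and N = N and u = u and s = s and t = t] le' h j 1
      by (simp only: pow_order_def stu Un_iff less_Suc_eq_le not_False_eq_True if_True if_False simp_thms)
  next
    case 2
    then have "u + t = s" using un(2) by simp
    then show ?thesis
      using pow_order_union_arith(2)[where j = j and h = h and N = N and u = u and s = s and t = t] le' h j 2
      by (simp only: pow_order_def stu Un_iff less_Suc_eq_le not_False_eq_True if_True if_False simp_thms)
  next
    case 3
    then have "u + s = t" using un(3) by simp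
    then show ?thesis
      using pow_order_union_arith(3)[where j = j and h = h and N = N and u = u and s = s and t = t] le' h j 3
      by (simp only: pow_order_def stu Un_iff less_Suc_eq_le not_False_eq_True if_True if_False simp_thms)
  qed
qed

lemma pow_order_split:
  assumes j: "1 \<le> j" "j < Suc h" and U: "U \<in> adm"
  shows "\<exists>S\<in>adm. \<exists>T\<in>adm. S \<inter> T = {} \<and> S \<union> T = U \<and> pow_order 1 S + pow_order j T \<le> pow_order (Suc j) U"
proof -
  have sub: "U \<subseteq> {0..r}" and le: "sz U \<le> N" using U by (auto simp: adm_def)
  have fin: "finite U" using sub finite_subset by auto
  have empty: "sz {} = 0" "{} \<in> adm" by (auto simp: sz_def adm_def)
  \<comment> \<open>In \<open>whole\<close> and \<open>none\<close> the second factor is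
    \<open>x ^ j\<close>, in \<open>one\<close> a single variable is split off, and in
    \<open>dual\<close> a dual of higher degree is contracted. A monomial of degree \<open>N\<close>
    switches from \<open>whole\<close> to \<open>one\<close> at \<open>j = h\<close>: up to there
    \<open>f\<close> is multiplied by powers of \<open>x\<close>, afterwards \<open>y\<close> is
    used as a product of variables.\<close>
  consider (whole) "sz U = N" "0 \<in> U \<or> j < h" | (none) "U = {}"
    | (one) "0 \<notin> U" "U \<noteq> {}" "sz U < N \<or> j = h" | (dual) "0 \<in> U" "sz U < N"
    using le j by fastforce
  then show ?thesis
  proof cases
    case whole
    then have "pow_order 1 U + pow_order j {} \<le> pow_order (Suc j) U" using h by (auto simp: pow_order_def empty)
    then show ?thesis using U empty by (intro bexI[of _ U] bexI[of _ "{}"]) auto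
  next
    case none
    then have "pow_order 1 {} + pow_order j {} \<le> pow_order (Suc j) U" using h by (auto simp: pow_order_def empty)
    then show ?thesis using U none empty by (intro bexI[of _ "{}"] bexI[of _ "{}"]) auto
  next
    case one
    then obtain i where i: "i \<in> U" by auto
    have sz: "sz {i} = 1" "Suc (sz (U - {i})) = sz U"
      using one(1) card.remove[OF fin i] i by (simp_all add: sz_def) (metis)
    then have "pow_order 1 {i} + pow_order j (U - {i}) \<le> pow_order (Suc j) U"
      using one h i le by (auto simp: pow_order_def)
    moreover have "{i} \<in> adm" "U - {i} \<in> adm" using sz i sub le h by (auto simp: adm_def)
    ultimately show ?thesis using i by (intro bexI[of _ "{i}"] bexI[of _ "U - {i}"]) auto
  next
    case dual
    have "card U + sz U = Suc r"
      using card_Diff_subset[OF fin sub] card_mono[OF _ sub] dual by (simp add: sz_def)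
    moreover have "card (U - {0}) = card U - 1" using dual fin by simp
    \<comment> \<open>The factor \<open>S\<close> shall be the dual of a monomial of degree
      \<open>N - 1\<close>. Degree \<open>N\<close> would not do, since those duals start only at
      order \<open>h - 1\<close> instead of 0. The bound on \<open>r\<close> ensures that
      \<open>U\<close> has enough variables to move to \<open>T\<close>.\<close>
    ultimately have "N - 1 - sz U \<le> card (U - {0})" using r by linarith
    then obtain T where T: "T \<subseteq> U - {0}" "card T = N - 1 - sz U"
      by (metis obtain_subset_with_card_n)
    have T': "T \<subseteq> {0..r}" "0 \<notin> T" "sz T = N - 1 - sz U" using T sub by (auto simp: sz_def)
    define S where "S = U - T"
    have S: "S \<subseteq> {0..r}" "0 \<in> S" "S \<inter> T = {}" "S \<union> T = U" using T dual sub by (auto simp: S_def)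
    have szS: "sz S = N - 1" using sz_union(2)[OF S(1) T'(1) S(3,2)] T'(3) S(4) dual by simp
    have "pow_order 1 S + pow_order j T \<le> pow_order (Suc j) U"
      using S(2) T' szS dual h by (auto simp: pow_order_def)
    moreover have "S \<in> adm" "T \<in> adm" using S T' szS by (auto simp: adm_def)
    ultimately show ?thesis using S by (intro bexI[of _ S] bexI[of _ T]) auto
  qed
qed

lemma ideal_power_pow_order: "1 \<le> j \<Longrightarrow> j \<le> Suc h \<Longrightarrow> ideal_power R (max_ideal R) j = enc ` lat (pow_order j)"
  using pow_order_1 pow_order_union pow_order_split by (rule ideal_power_lat)

section \<open>The drop of the Hilbert function\<close>

lemma hilbert_function_pow_order:
  assumes "1 \<le> j" "j \<le> h"
  shows "hilbert_function R j = card {S \<in> adm. pow_order (Suc j) S \<noteq> pow_order j S}"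
proof (rule hilbert_function_lat)
  show "ideal_power R (max_ideal R) j = enc ` lat (pow_order j)"
    by (rule ideal_power_pow_order) (use assms in auto)
  show "ideal_power R (max_ideal R) (Suc j) = enc ` lat (pow_order (Suc j))"
    by (rule ideal_power_pow_order) (use assms in auto)
  show "pow_order j S \<le> pow_order (Suc j) S \<and> pow_order (Suc j) S \<le> pow_order j S + 1" for S
    by (auto simp: pow_order_def)
qed

text \<open>From \<open>h - 1\<close> to \<open>h\<close> the bound at a monomial of degree
  \<open>N\<close> stops growing, while it starts growing at the monomials of degree
  \<open>h\<close> and at the duals of degree \<open>N - h\<close>. Nothing else changes.\<close>

lemma hilbert_drop: "hilbert_function R h + (r choose N) \<le> hilbert_function R (h - 1) + (r choose h) + (r choose (N - h))"
proof -
  define D where "D = (\<lambda>j. {S \<in> adm. pow_order (Suc j) S \<noteq> pow_order j S})"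
  define P where "P = (\<lambda>k. {S. S \<subseteq> {1..r} \<and> card S = k})"
  have cardP: "card (P k) = r choose k" for k
    unfolding P_def using n_subsets[of "{1..r}" k] by simp
  have fin: "finite (D j)" "finite (P k)" for j k
    using fin_adm by (auto simp: D_def P_def)
  have P_iff: "S \<in> P k \<longleftrightarrow> S \<subseteq> {0..r} \<and> 0 \<notin> S \<and> sz S = k" for S k
  proof -
    have "S \<subseteq> {1..r} \<longleftrightarrow> S \<subseteq> {0..r} \<and> 0 \<notin> S" by (auto simp: subset_iff) (metis Suc_leI gr0I)
    then show ?thesis by (auto simp: P_def sz_def)
  qed
  have co: "S \<in> (\<lambda>T. {0..r} - T) ` P k" if "S \<subseteq> {0..r}" "0 \<in> S" "sz S = k" for S k
  proof (rule image_eqI)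
    show "S = {0..r} - ({0..r} - S)" using that(1) by auto
    show "{0..r} - S \<in> P k" using that sz_compl[OF that(1)] by (auto simp: P_iff)
  qed
  have PN: "P N \<subseteq> D (h - 1)"
  proof
    fix S assume "S \<in> P N"
    then have *: "S \<subseteq> {0..r}" "0 \<notin> S" "sz S = N" by (simp_all add: P_iff)
    then have "pow_order (Suc (h - 1)) S \<noteq> pow_order (h - 1) S" using h by (simp add: pow_order_def)
    with * show "S \<in> D (h - 1)" by (simp add: D_def adm_def)
  qed
  have "D h \<subseteq> (D (h - 1) - P N) \<union> P h \<union> (\<lambda>T. {0..r} - T) ` P (N - h)"
  proof
    fix S assume S: "S \<in> D h"
    then have *: "S \<subseteq> {0..r}" "sz S \<le> N" "pow_order (Suc h) S \<noteq> pow_order h S" by (auto simp: D_def adm_def)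
    show "S \<in> (D (h - 1) - P N) \<union> P h \<union> (\<lambda>T. {0..r} - T) ` P (N - h)"
    proof (cases "0 \<in> S")
      case True
      have "S \<in> D (h - 1) \<or> sz S = N - h"
        using * True h by (auto simp: D_def adm_def pow_order_def split: if_splits)
      then show ?thesis using True *(1) co by (auto simp: P_iff)
    next
      case False
      have "S \<in> D (h - 1) \<and> sz S \<noteq> N \<or> sz S = h"
        using * False h by (auto simp: D_def adm_def pow_order_def split: if_splits)
      then show ?thesis using False *(1) by (auto simp: P_iff)
    qed
  qed
  then have "card (D h) \<le> card ((D (h - 1) - P N) \<union> P h \<union> (\<lambda>T. {0..r} - T) ` P (N - h))"
    using fin by (intro card_mono) auto
  also have "\<dots> \<le> card (D (h - 1) - P N) + card (P h) + card ((\<lambda>T. {0..r} - T) ` P (N - h))"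
    by (meson add_le_mono card_Un_le le_refl le_trans)
  also have "\<dots> \<le> (card (D (h - 1)) - card (P N)) + card (P h) + card (P (N - h))"
    using card_image_le[OF fin(2)[of "N - h"]] fin PN by (simp add: card_Diff_subset)
  finally have "card (D h) + card (P N) \<le> card (D (h - 1)) + card (P h) + card (P (N - h))"
    using card_mono[OF fin(1) PN] by linarith
  moreover have "hilbert_function R h = card (D h)" "hilbert_function R (h - 1) = card (D (h - 1))"
    unfolding D_def using h hilbert_function_pow_order[of h] hilbert_function_pow_order[of "h - 1"] by simp_all
  ultimately show ?thesis by (simp add: cardP)
qed

text \<open>With \<open>r - (N - 1) \<ge> 3 * N\<close> the last step of the binomial row multiplies
  by at least 3, and each of the three summands is at most \<open>r choose (N - 1)\<close>. The
  summand \<open>r\<close> is the guaranteed drop.\<close>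

lemma binomial_drop: "(r choose h) + (r choose (N - h)) + r \<le> r choose N"
proof -
  obtain M where M: "N = Suc M" using h by (cases N) auto
  have mono: "r choose k \<le> r choose M" if "k \<le> M" for k
    using that r M by (intro binomial_mono) auto
  have "N * (r choose N) = (r - M) * (r choose M)"
    using M r by (metis binomial_absorb_comp binomial_absorption mult.commute)
  moreover have "N * (3 * (r choose M)) \<le> (r - M) * (r choose M)"
    using r M by (simp add: mult.assoc[symmetric])
  ultimately have "3 * (r choose M) \<le> r choose N"
    using M by (metis mult_le_cancel1 zero_less_Suc)
  moreover have "r \<le> r choose M" using mono[of 1] h M by simp
  moreover have "r choose h \<le> r choose M" "r choose (N - h) \<le> r choose M" using mono h M by auto
  ultimately show ?thesis by linarith
qed

lemma nilpotency_N: "nilpotency R N"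
proof -
  have sz: "sz S = card S" "S \<subseteq> {0..r}" if "S \<subseteq> {1..N}" for S
    using that r by (auto simp: sz_def)
  have "card S \<le> N" if "S \<subseteq> {1..N}" for S
    using card_mono[OF _ that] by simp
  then have "nilpotency R (card {1..N})"
    using sz h by (intro nilpotency_ge) (auto simp: adm_def order_def)
  then show ?thesis by simp
qed

end

section \<open>Infinitely many isomorphism classes\<close>

theorem theorem3p3:
  fixes m h :: nat
  assumes "m \<ge> 1" and "h > 1"
    and "h \<notin> range (\<lambda>k. 14 + 22 * k) \<union> range (\<lambda>k. 35 + 46 * k)"
  shows "\<exists>\<F> :: complex fps ring set.
           infinite \<F> \<and>
           (\<forall>R\<in>\<F>. gorenstein_local_ring R \<and> krull_dim R = 1 \<and>
              int (hilbert_function R (h - 1)) - int (hilbert_function R h) > int m) \<and>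
           (\<forall>R\<in>\<F>. \<forall>S\<in>\<F>. R \<noteq> S \<longrightarrow> \<not> R \<simeq> S)"
proof -
  define G :: "complex fps ring set" where
    "G = {R. gorenstein_local_ring R \<and> krull_dim R = 1 \<and>
      int (hilbert_function R (h - 1)) - int (hilbert_function R h) > int m \<and> finite {n. nilpotency R n}}"
  \<comment> \<open>The finiteness condition in \<open>G\<close> makes this maximum
    meaningful.\<close>
  define \<nu> :: "complex fps ring \<Rightarrow> nat" where "\<nu> = (\<lambda>R. Max {n. nilpotency R n})"
  have ex: "\<exists>R\<in>G. N \<le> \<nu> R" if N: "h < N" for N
  proof -
    \<comment> \<open>The number of variables is \<open>4 * N + m\<close> because the drop is at
      least this number, which exceeds \<open>m\<close>.\<close>
    interpret D: drop_datum h N "4 * N + m" using assms N by unfold_locales auto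
    have "{n. nilpotency D.R n} \<subseteq> {..card {0..4 * N + m}}" using D.nilpotency_le by auto
    then have fin: "finite {n. nilpotency D.R n}" by (rule finite_subset) simp
    moreover have "int (hilbert_function D.R (h - 1)) - int (hilbert_function D.R h) > int m"
      using D.hilbert_drop D.binomial_drop N by linarith
    ultimately have "D.R \<in> G" by (simp add: G_def D.gorenstein_R D.krull_dim_R)
    moreover have "N \<le> \<nu> D.R" unfolding \<nu>_def using fin D.nilpotency_N by (intro Max_ge) auto
    ultimately show ?thesis by blast
  qed
  have ring: "ring R" if "R \<in> G" for R
    using that by (auto simp: G_def gorenstein_local_ring_def noetherian_local_ring_def cring_def)
  have iso: "\<nu> R = \<nu> S" if "R \<in> G" "S \<in> G" "R \<simeq> S" for R S
  proof -
    have "S \<simeq> R" using that(3) ring[OF that(1)] by (rule ring_iso_sym[rotated])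
    then have "nilpotency R n \<longleftrightarrow> nilpotency S n" for n
      using nilpotency_iso[of R S n] nilpotency_iso[of S R n] that ring by blast
    then have "nilpotency R = nilpotency S" by (rule ext)
    then show ?thesis by (simp add: \<nu>_def)
  qed
  \<comment> \<open>One ring is selected for each value of the invariant.\<close>
  define F where "F = inv_into G \<nu> ` \<nu> ` G"
  have inv: "inv_into G \<nu> d \<in> G" "\<nu> (inv_into G \<nu> d) = d" if "d \<in> \<nu> ` G" for d
    using that by (auto simp: inv_into_into f_inv_into_f)
  have "infinite (\<nu> ` G)"
  proof
    assume "finite (\<nu> ` G)"
    then obtain B where B: "\<And>R. R \<in> G \<Longrightarrow> \<nu> R \<le> B" by (meson finite_nat_set_iff_bounded_le imageI)
    obtain R where "R \<in> G" "Suc (h + B) \<le> \<nu> R" using ex[of "Suc (h + B)"] by auto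
    with B[of R] show False by simp
  qed
  moreover have "inj_on (inv_into G \<nu>) (\<nu> ` G)" by (metis inj_onI inv(2))
  ultimately have "infinite F" unfolding F_def by (simp add: finite_image_iff)
  moreover have "F \<subseteq> G" using inv by (auto simp: F_def)
  moreover have "R = S" if R: "R \<in> F" and S: "S \<in> F" and RS: "R \<simeq> S" for R S
  proof -
    have "\<nu> R = \<nu> S" using R S \<open>F \<subseteq> G\<close> RS by (intro iso) auto
    then show ?thesis using R S inv by (auto simp: F_def)
  qed
  ultimately show ?thesis by (intro exI[of _ F]) (auto simp: G_def)
qed

end
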